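(* Let $r\ge 2$ and let $A_1,\dots,A_r$ be irredundant homogeneous partition regular linear equations, each on at least $3$ variables, where $m(A_1)\geq m(A_2)\geq \dots \geq m(A_r)$. Then there exists $c>0$ such that the following holds: if $p=p(n)$ satisfies $p<c\,n^{-1/m(A_1,A_2)}$, then $$\lim_{n \to \infty} \mathbb{P}\big[\,[n]_p \text{ is } (A_1,\dots, A_r)\text{-Rado}\,\big]=0 .$$
   Context: $\mathbb{N}$ is the set of positive integers and $[n]:=\{1,\dots,n\}$. The random set $[n]_p$ is obtained by including each element of $[n]$ with probability $p$, independently of all other elements. A homogeneous linear equation $A$ on $k$ variables is an equation $A'x=0$, where $A'$ is a $1\times k$ integer matrix all of whose entries are non-zero (the underlying matrix). It is partition regular if for every finite colouring of $\mathbb{N}$ there is a monochromatic solution in $\mathbb N$ (entries not required to be distinct). For a set $S$ of integers, a $k$-distinct solution of $A$ in $S$ is a solution $x=(x_1,\dots,x_k)\in S^k$ with pairwise distinct entries. $A$ is irredundant if it has a $k$-distinct solution in $\mathbb{N}$. A set $S$ of integers is $(A_1,\dots,A_r)$-Rado if for every $r$-colouring of $S$ (with colours $1,\dots,r$) there is some $i\in[r]$ such that there is a $k_i$-distinct solution of $A_i$ in $S$ all of whose entries have colour $i$, where $k_i$ is the number of variables of $A_i$. For an integer matrix $A$ with columns indexed by $[k]$ and a partition $[k]=W\,\dot\cup\,\overline{W}$, let $A_{\overline{W}}$ be the matrix obtained from $A$ by restricting to the columns indexed by $\overline W$, with $\operatorname{rank}(A_{\overline{W}})=0$ if $\overline W=\emptyset$.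 Define $$m(A):=\max_{\substack{W \dot{\cup} \overline{W} = [k] \\ |W|\geq 2}} \frac{|W|-1}{|W|-1+\operatorname{rank}(A_{\overline{W}})-\operatorname{rank}(A)},$$ and for integer matrices $A,B$, where $A$ has $k_A$ columns, $$m(A,B):= \max_{\substack{W \dot\cup \overline{W} = [k_A]\\ |W| \geq 2}} \frac{|W|}{|W|-1+\operatorname{rank}(A_{\overline{W}})-\operatorname{rank}(A)+1/m(B)}.$$ For linear equations, $m(A)$ and $m(A,B)$ are defined to be the corresponding quantities of the underlying matrices. *)

theory Defs
  imports
    "HOL-Probability.Product_PMF"
    "Jordan_Normal_Form.DL_Rank"
    "Jordan_Normal_Form.DL_Submatrix"
begin

no_notation vec_nth (infixl "$" 90)

(* A homogeneous linear equation A' x = 0 is identified with its underlying one-row matrix A';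
   its number of variables is dim_col. *)
definition linear_equation :: "int mat \<Rightarrow> bool" where
  "linear_equation A \<longleftrightarrow> dim_row A = 1 \<and> (\<forall>j<dim_col A. A $$ (0, j) \<noteq> 0)"

definition solution_in :: "int mat \<Rightarrow> int set \<Rightarrow> int vec \<Rightarrow> bool" where
  "solution_in A S x \<longleftrightarrow>
     x \<in> carrier_vec (dim_col A) \<and> A *\<^sub>v x = 0\<^sub>v (dim_row A) \<and> (\<forall>j<dim_col A. x $ j \<in> S)"

definition distinct_solution_in :: "int mat \<Rightarrow> int set \<Rightarrow> int vec \<Rightarrow> bool" where
  "distinct_solution_in A S x \<longleftrightarrow>
     solution_in A S x \<and> (\<forall>i<dim_col A. \<forall>j<dim_col A. i \<noteq> j \<longrightarrow> x $ i \<noteq> x $ j)"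

definition partition_regular :: "int mat \<Rightarrow> bool" where
  "partition_regular A \<longleftrightarrow>
     (\<forall>colour :: int \<Rightarrow> nat. finite (colour ` {1..}) \<longrightarrow>
        (\<exists>x. solution_in A {1..} x \<and> (\<exists>c. \<forall>j<dim_col A. colour (x $ j) = c)))"

definition irredundant :: "int mat \<Rightarrow> bool" where
  "irredundant A \<longleftrightarrow> (\<exists>x. distinct_solution_in A {1..} x)"

(* S is (A 1, ..., A r)-Rado. *)
definition rado :: "nat \<Rightarrow> (nat \<Rightarrow> int mat) \<Rightarrow> int set \<Rightarrow> bool" where
  "rado r A S \<longleftrightarrow>
     (\<forall>colour :: int \<Rightarrow> nat. (\<forall>s\<in>S. colour s \<in> {1..r}) \<longrightarrow>
        (\<exists>i\<in>{1..r}. \<exists>x. distinct_solution_in (A i) S x \<and>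
           (\<forall>j<dim_col (A i). colour (x $ j) = i)))"

definition rank_rat :: "int mat \<Rightarrow> nat" where
  "rank_rat A = vec_space.rank (dim_row A) (map_mat rat_of_int A)"

(* The rank of A restricted to the columns outside W. Columns are indexed from 0.
   If no column is left, this is the dimension of the span of the empty set, i.e. 0. *)
definition rank_off :: "int mat \<Rightarrow> nat set \<Rightarrow> nat" where
  "rank_off A W = rank_rat (submatrix A UNIV ({..<dim_col A} - W))"

(* The denominators in the two definitions below are positive for the equations considered
   (at least 3 variables); for other matrices, division by zero may occur and yields 0. *)
definition m_single :: "int mat \<Rightarrow> real" where
  "m_single A =
     (MAX W \<in> {W. W \<subseteq> {..<dim_col A} \<and> 2 \<le> card W}.
        (real (card W) - 1) / (real (card W) - 1 + real (rank_off A W) - real (rank_rat A)))"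

definition m_pair :: "int mat \<Rightarrow> int mat \<Rightarrow> real" where
  "m_pair A B =
     (MAX W \<in> {W. W \<subseteq> {..<dim_col A} \<and> 2 \<le> card W}.
        real (card W) /
          (real (card W) - 1 + real (rank_off A W) - real (rank_rat A) + 1 / m_single B))"

(* The distribution of the random set [n]_p. *)
definition random_subset :: "nat \<Rightarrow> real \<Rightarrow> int set pmf" where
  "random_subset n p =
     map_pmf (\<lambda>f. {i \<in> {1..int n}. f i}) (Pi_pmf {1..int n} False (\<lambda>_. bernoulli_pmf p))"

end

theory Submission
  imports Defs "HOL-Real_Asymp.Real_Asymp"
begin

text \<open>
  A set that can be coloured with the first two colours is not Rado, so only the equations \<open>A 1\<close> and
  \<open>A 2\<close> matter.  Let \<open>a\<close> and \<open>b\<close> be their numbers of variables.  A single equation has rank one,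
  which makes the densities explicit: \<open>m_single\<close> is \<open>(k - 1) / (k - 2)\<close> for \<open>k\<close> variables, so \<open>a \<le> b\<close>,
  and the condition on \<open>p\<close> reads \<open>n * p < c * n powr y\<close> for \<open>y = b / (a * (b - 1))\<close>
  (\<open>m_single_equation\<close>, \<open>m_pair_equations\<close>).

  Suppose that \<open>S\<close> is Rado.  The entry sets of the distinct solutions in \<open>S\<close>, called edges, admit no proper
  colouring, and a minimal family without a proper colouring has the crossing property
  (\<open>critical_crossing\<close>): each edge \<open>e\<close> of one kind is met by an edge of the other kind exactly in \<open>v\<close>,
  for every vertex \<open>v\<close> of \<open>e\<close>.  So the family has no loose ends, and exploring it edge by edge has to
  close cycles in several places, or else goes on for very long.

  Both are unlikely in the random set.  If a configuration is built from \<open>e\<close> edges, each bringing at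
  least one new vertex, each edge determines one of its vertices from the others, so a configuration with
  \<open>v\<close> vertices is expected about \<open>n powr (y * v - e)\<close> times.  The integer \<open>potential\<close> is a multiple of this
  exponent.  While the exploration is tree-like, it never stays above its initial positive value; every
  coincidence lowers it, and a negative value is not expected to occur.  Explorations of more than
  \<open>(ln n)\<^sup>2\<close> steps do not occur either, since each step loses a constant factor if \<open>c\<close> is small.  The union bound over all explorations is
  \<open>layer_weight\<close>: it assigns weights to the states of an exploration in such a way that the
  total weight of the possible successors of a state is at most \<open>3 / 4\<close> of its own weight.

  It remains to show that the crossing property forces an exploration to be too dense or too long.
  When an exploration has come to an end, consider its last edge.  An edge that crosses it in a new
  vertex only could have been added in its place, and it has just one new vertex.  This lowers the potential
  far enough, unless \<open>a = b = 3\<close>.  For \<open>a < b\<close> (\<open>contradiction_smaller\<close>) the exploration proceeds in rounds that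
  add a solution of the second equation together with solutions of the first equation through all its
  new vertices; for \<open>a = b\<close> (\<open>contradiction_same_size\<close>) single edges are added.  The case \<open>a = b = 3\<close> is
  special, because four triples that pairwise meet in six distinct vertices have the crossing property
  and may occur with positive probability.  They are the only exception, and they can be coloured
  (\<open>triangle_contradiction\<close>).
\<close>

section \<open>Densities of single equations\<close>

lemma rank_single_row:
  fixes A :: "int mat"
  assumes "dim_row A = 1" and "\<And>j. j < dim_col A \<Longrightarrow> A $$ (0, j) \<noteq> 0"
  shows "rank_rat A = (if dim_col A = 0 then 0 else 1)"
proof -
  define M where "M = map_mat rat_of_int A"
  interpret vec_space "TYPE(rat)" 1 .
  have M: "M \<in> carrier_mat 1 (dim_col A)" using assms by (auto simp: M_def)
  have up0: "rank M \<le> dim_col A" by (rule rank_le_nc[OF M])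
  have up1: "rank M \<le> 1"
    by (rule rank_le_1_product_entries[OF M, of "\<lambda>_. 1" "\<lambda>c. M $$ (0, c)"]) (use M in auto)
  have lo: "1 \<le> rank M" if "dim_col A \<noteq> 0"
  proof -
    define v where "v = col M 0"
    have v: "v \<in> set (cols M)" using that M by (auto simp: v_def cols_def)
    have vc: "v \<in> carrier_vec 1" unfolding v_def by (rule carrier_vecI) (use M in auto)
    have "v $ 0 = of_int (A $$ (0, 0))"
      using that assms(1) by (simp add: v_def M_def)
    then have v0: "v $ 0 \<noteq> 0" using that assms(2)[of 0] by simp
    define C where "C = mat_of_cols 1 [v]"
    have C: "C \<in> carrier_mat 1 1" by (auto simp: C_def mat_of_cols_def)
    have cC: "cols C = [v]" using vc by (simp add: C_def cols_mat_of_cols)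
    have "lin_indpt {v}"
    proof
      assume "lin_dep {v}"
      then have "lin_dep (set (cols C))" by (simp add: cC)
      from lin_depE[OF C this] cC obtain w
        where w: "w \<in> carrier_vec 1" "w \<noteq> 0\<^sub>v 1" "C *\<^sub>v w = 0\<^sub>v 1" by auto
      have "w $ 0 \<noteq> 0" using w(1,2) by (metis carrier_vecD eq_vecI index_zero_vec(1) index_zero_vec(2) less_one)
      moreover have "(C *\<^sub>v w) $ 0 = v $ 0 * w $ 0"
        using C w(1) by (simp add: scalar_prod_def C_def mat_of_cols_def)
      ultimately show False using v0 w(3) by simp
    qed
    from rank_ge_card_indpt[OF M _ this] v show ?thesis by simp
  qed
  show ?thesis using up0 up1 lo assms(1) unfolding rank_rat_def M_def[symmetric] by auto
qed

lemma rank_equation: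
  assumes "linear_equation A" "0 < dim_col A"
  shows "rank_rat A = 1"
  using assms rank_single_row[of A] by (auto simp: linear_equation_def)

text \<open>Every nonempty set of columns of a row with nonzero entries still has rank one, so the rank
drops only if all columns are deleted.  Hence \<open>W = {..<k}\<close> is the only exceptional set in both
maxima below, and it is where they are attained.\<close>

lemma rank_off_equation:
  assumes "linear_equation A" "W \<subseteq> {..<dim_col A}"
  shows "rank_off A W = (if W = {..<dim_col A} then 0 else 1)"
proof -
  define J where "J = {..<dim_col A} - W"
  define B where "B = submatrix A UNIV J"
  have J: "{j. j < dim_col A \<and> j \<in> J} = J" by (auto simp: J_def)
  have r: "dim_row B = 1" using assms by (auto simp: B_def dim_submatrix linear_equation_def)
  have c: "dim_col B = card J" by (simp add: B_def dim_submatrix J)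
  have "B $$ (0, j) \<noteq> 0" if "j < dim_col B" for j
  proof -
    have j: "j < card {j. j < dim_col A \<and> j \<in> J}" using that c J by simp
    have "B $$ (0, j) = A $$ (pick UNIV 0, pick J j)" unfolding B_def
      by (rule submatrix_index) (use assms j in \<open>auto simp: linear_equation_def\<close>)
    moreover have "pick J j < dim_col A" using j pick_le by blast
    ultimately show ?thesis using assms by (auto simp: linear_equation_def pick_UNIV)
  qed
  then have "rank_rat B = (if card J = 0 then 0 else 1)" using rank_single_row[of B] r c by auto
  moreover have "card J = 0 \<longleftrightarrow> W = {..<dim_col A}" using assms(2) by (auto simp: J_def)
  ultimately show ?thesis by (simp add: rank_off_def B_def J_def)
qed

lemma m_single_equation:
  assumes "linear_equation A" "3 \<le> dim_col A"
  shows "m_single A = (real (dim_col A) - 1) / (real (dim_col A) - 2)"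
proof -
  let ?k = "dim_col A"
  let ?Ws = "{W. W \<subseteq> {..<?k} \<and> 2 \<le> card W}"
  have fin: "finite ?Ws" by simp
  have "(real (card W) - 1) / (real (card W) - 1 + real (rank_off A W) - real (rank_rat A))
          = (if W = {..<?k} then (real ?k - 1) / (real ?k - 2) else 1)" if "W \<in> ?Ws" for W
    using that assms by (auto simp: rank_equation rank_off_equation)
  then have "m_single A = (MAX W \<in> ?Ws. (if W = {..<?k} then (real ?k - 1) / (real ?k - 2) else 1))"
    unfolding m_single_def by (intro arg_cong[of _ _ Max] image_cong) auto
  also have "\<dots> = (real ?k - 1) / (real ?k - 2)"
  proof (rule Max_eqI)
    show "finite ((\<lambda>W. if W = {..<?k} then (real ?k - 1) / (real ?k - 2) else 1) ` ?Ws)" using fin by blast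
    show "(real ?k - 1) / (real ?k - 2) \<in> (\<lambda>W. if W = {..<?k} then (real ?k - 1) / (real ?k - 2) else 1) ` ?Ws"
      using assms by (intro image_eqI[of _ _ "{..<?k}"]) auto
    show "x \<le> (real ?k - 1) / (real ?k - 2)"
      if "x \<in> (\<lambda>W. if W = {..<?k} then (real ?k - 1) / (real ?k - 2) else 1) ` ?Ws" for x
      using that assms(2) by (auto simp: divide_simps split: if_splits)
  qed
  finally show ?thesis .
qed

text \<open>The map \<open>k \<mapsto> (k - 1) / (k - 2)\<close> is decreasing, so ordering equations by their density means
ordering them by their number of variables.\<close>

lemma dim_col_le_if_m_single_ge:
  assumes "linear_equation A" "3 \<le> dim_col A" "linear_equation B" "3 \<le> dim_col B"
    and "m_single B \<le> m_single A"
  shows "dim_col A \<le> dim_col B"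
proof -
  have k: "real (dim_col A) \<ge> 3" "real (dim_col B) \<ge> 3" using assms by auto
  have "(real (dim_col B) - 1) / (real (dim_col B) - 2) \<le> (real (dim_col A) - 1) / (real (dim_col A) - 2)"
    using assms m_single_equation by simp
  then have "(real (dim_col B) - 1) * (real (dim_col A) - 2) \<le> (real (dim_col A) - 1) * (real (dim_col B) - 2)"
    using k by (simp add: divide_simps split: if_splits)
  then show ?thesis by (simp add: algebra_simps)
qed

lemma m_pair_equations:
  assumes "linear_equation A" "3 \<le> dim_col A" "linear_equation B" "dim_col A \<le> dim_col B"
  defines "a \<equiv> real (dim_col A)" and "b \<equiv> real (dim_col B)"
  shows "m_pair A B = a * (b - 1) / (a * (b - 1) - b)"
proof -
  have k: "a \<ge> 3" "a \<le> b" using assms by auto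
  let ?Ws = "{W. W \<subseteq> {..<dim_col A} \<and> 2 \<le> card W}"
  let ?\<epsilon> = "1 / (b - 1)"
  let ?h = "\<lambda>W. if W = {..<dim_col A} then a / (a - 1 - ?\<epsilon>) else real (card W) / (real (card W) - ?\<epsilon>)"
  have \<epsilon>: "?\<epsilon> > 0" "?\<epsilon> \<le> 1/2" using k by (auto simp: divide_simps)
  have \<epsilon>2: "(a - 2) * ?\<epsilon> < 2" using k by (simp add: divide_simps)
  have mB: "1 / m_single B = 1 - ?\<epsilon>"
  proof -
    have "m_single B = (b - 1) / (b - 2)" using assms m_single_equation[of B] by simp
    then have "1 / m_single B = (b - 2) / (b - 1)" by simp
    then show ?thesis using k by (simp add: field_simps)
  qed
  have "real (card W) / (real (card W) - 1 + real (rank_off A W) - real (rank_rat A) + 1 / m_single B) = ?h W"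
    if "W \<in> ?Ws" for W
    using that assms(1,2) by (auto simp: rank_equation rank_off_equation mB a_def)
  then have "m_pair A B = (MAX W \<in> ?Ws. ?h W)"
    unfolding m_pair_def by (intro arg_cong[of _ _ Max] image_cong) auto
  also have "\<dots> = a / (a - 1 - ?\<epsilon>)"
  proof (rule Max_eqI)
    show "finite (?h ` ?Ws)" by simp
    show "a / (a - 1 - ?\<epsilon>) \<in> ?h ` ?Ws"
      using assms by (intro image_eqI[of _ _ "{..<dim_col A}"]) auto
    fix x assume "x \<in> ?h ` ?Ws"
    then obtain W where W: "W \<in> ?Ws" "x = ?h W" by blast
    have w: "real (card W) \<ge> 2" using W by auto
    have p: "a - 1 - ?\<epsilon> > 0" "real (card W) - ?\<epsilon> > 0" using \<epsilon> w k by linarith+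
    \<comment> \<open>The terms of the proper subsets decrease with their size; those of size 2 stay below the full set because \<open>(a - 2) * \<epsilon> < 2\<close>.\<close>
    have "real (card W) / (real (card W) - ?\<epsilon>) \<le> a / (a - 1 - ?\<epsilon>)"
    proof -
      have "a * ?\<epsilon> \<le> 2 + 2 * ?\<epsilon>" using \<epsilon>2 by (simp add: diff_divide_distrib)
      also have "\<dots> \<le> real (card W) * (1 + ?\<epsilon>)" using mult_right_mono[OF w, of "1 + ?\<epsilon>"] \<epsilon>(1) by (simp add: distrib_left)
      finally have "real (card W) * (a - 1 - ?\<epsilon>) \<le> a * (real (card W) - ?\<epsilon>)" by (simp add: algebra_simps)
      then show ?thesis using p by (simp add: divide_le_eq pos_le_divide_eq mult.commute)
    qed
    then show "x \<le> a / (a - 1 - ?\<epsilon>)" using W by auto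
  qed
  also have "\<dots> = a * (b - 1) / (a * (b - 1) - b)"
  proof -
    have "a - 1 - ?\<epsilon> = (a * (b - 1) - b) / (b - 1)" using k by (simp add: field_simps)
    then show ?thesis by simp
  qed
  finally show ?thesis .
qed

section \<open>Counting solution sets\<close>

text \<open>Colourings see only the set of entries of a solution, so the hypergraph of a distinct-solution
problem has these sets as its edges.\<close>

definition solution_sets :: "nat \<Rightarrow> (nat \<Rightarrow> int) \<Rightarrow> int set set" where
  "solution_sets k \<alpha> = {x ` {..<k} | x. inj_on x {..<k} \<and> (\<Sum>j<k. \<alpha> j * x j) = 0}"

lemma solution_sets_card: "g \<in> solution_sets k \<alpha> \<Longrightarrow> finite g \<and> card g = k"
  by (auto simp: solution_sets_def card_image)

text \<open>The new elements \<open>N\<close> occupy a set \<open>J\<close> of \<open>m\<close> coordinates of a solution whose other entries are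
taken from \<open>V\<close>.  Once \<open>J\<close>, the entries outside \<open>J\<close> and all but one of the entries in \<open>J\<close> are
chosen, the equation determines the last entry, because its coefficient is nonzero.\<close>

lemma card_extensions:
  assumes \<alpha>: "\<And>j. j < k \<Longrightarrow> \<alpha> j \<noteq> 0" and V: "finite V" and m: "1 \<le> m" "m \<le> k"
  shows "card {N. N \<subseteq> {1..int n} \<and> card N = m \<and> (\<exists>g\<in>solution_sets k \<alpha>. N \<subseteq> g \<and> g - N \<subseteq> V)}
           \<le> 2 ^ k * card V ^ (k - m) * n ^ (m - 1)" (is "card ?L \<le> _")
proof -
  define Js where "Js = {J. J \<subseteq> {..<k} \<and> card J = m}"
  define T where "T = (SIGMA J:Js. (({..<k} - J) \<rightarrow>\<^sub>E V) \<times> ((J - {Min J}) \<rightarrow>\<^sub>E {1..int n}))"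
  define val where "val J u v = (- (\<Sum>j\<in>{..<k} - J. \<alpha> j * u j) - (\<Sum>j\<in>J - {Min J}. \<alpha> j * v j)) div \<alpha> (Min J)"
    for J and u v :: "nat \<Rightarrow> int"
  define \<psi> where "\<psi> = (\<lambda>(J, u, v). insert (val J u v) (v ` (J - {Min J})))"
  have Js: "finite J" "J \<noteq> {}" "Min J \<in> J" "J \<subseteq> {..<k}" "card J = m" if "J \<in> Js" for J
  proof -
    show *: "finite J" "J \<noteq> {}" "J \<subseteq> {..<k}" "card J = m"
      using that m by (auto simp: Js_def intro: finite_subset)
    show "Min J \<in> J" using * by simp
  qed
  have finJs: "finite Js" by (simp add: Js_def)
  have cardJs: "card Js \<le> 2 ^ k"
  proof -
    have "card Js \<le> card (Pow {..<k})" by (rule card_mono) (auto simp: Js_def)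
    then show ?thesis by (simp add: card_Pow)
  qed
  have finT: "finite T"
    unfolding T_def using finJs V Js(1) by (intro finite_SigmaI finite_cartesian_product finite_PiE) auto
  have "card T = (\<Sum>J\<in>Js. card ((({..<k} - J) \<rightarrow>\<^sub>E V) \<times> ((J - {Min J}) \<rightarrow>\<^sub>E {1..int n})))"
    unfolding T_def using finJs V Js(1) by (intro card_SigmaI ballI finite_cartesian_product finite_PiE) auto
  also have "\<dots> = (\<Sum>J\<in>Js. card V ^ (k - m) * n ^ (m - 1))"
  proof (rule sum.cong[OF refl])
    fix J assume J: "J \<in> Js"
    have "card ({..<k} - J) = k - m" using Js[OF J] by (simp add: card_Diff_subset)
    moreover have "card (J - {Min J}) = m - 1" using Js[OF J] by simp
    ultimately show "card ((({..<k} - J) \<rightarrow>\<^sub>E V) \<times> ((J - {Min J}) \<rightarrow>\<^sub>E {1..int n})) = card V ^ (k - m) * n ^ (m - 1)"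
      using Js(1)[OF J] by (simp add: card_cartesian_product card_PiE)
  qed
  also have "\<dots> = card Js * (card V ^ (k - m) * n ^ (m - 1))" by simp
  finally have cT: "card T \<le> 2 ^ k * card V ^ (k - m) * n ^ (m - 1)"
    using cardJs by (simp add: mult.assoc)
  have "?L \<subseteq> \<psi> ` T"
  proof
    fix N assume N: "N \<in> ?L"
    then obtain x where x: "inj_on x {..<k}" "(\<Sum>j<k. \<alpha> j * x j) = 0" "N \<subseteq> x ` {..<k}" "x ` {..<k} - N \<subseteq> V"
      by (auto simp: solution_sets_def)
    define J where "J = {j \<in> {..<k}. x j \<in> N}"
    have xJ: "x ` J = N" using x(3) by (auto simp: J_def)
    have "inj_on x J" using x(1) by (rule inj_on_subset) (auto simp: J_def)
    then have "card J = m" using N xJ card_image by fastforce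
    then have J: "J \<in> Js" by (auto simp: Js_def J_def)
    define u where "u = restrict x ({..<k} - J)"
    define v where "v = restrict x (J - {Min J})"
    have "(\<Sum>j<k. \<alpha> j * x j) = (\<Sum>j\<in>{..<k} - J. \<alpha> j * x j) + (\<Sum>j\<in>J. \<alpha> j * x j)"
      by (rule sum.subset_diff) (use Js(4)[OF J] in auto)
    then have "\<alpha> (Min J) * x (Min J) = - (\<Sum>j\<in>{..<k} - J. \<alpha> j * x j) - (\<Sum>j\<in>J - {Min J}. \<alpha> j * x j)"
      using x(2) sum.remove[OF Js(1)[OF J] Js(3)[OF J], of "\<lambda>j. \<alpha> j * x j"] by simp
    also have "\<dots> = - (\<Sum>j\<in>{..<k} - J. \<alpha> j * u j) - (\<Sum>j\<in>J - {Min J}. \<alpha> j * v j)"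
      by (simp add: u_def v_def)
    finally have "val J u v = x (Min J)"
      using \<alpha>[of "Min J"] Js(3,4)[OF J] unfolding val_def
      by (metis lessThan_iff nonzero_mult_div_cancel_left subsetD)
    moreover have "v ` (J - {Min J}) = x ` (J - {Min J})" by (simp add: v_def)
    ultimately have "\<psi> (J, u, v) = x ` J" using Js(3)[OF J] by (auto simp: \<psi>_def)
    moreover have "u \<in> ({..<k} - J) \<rightarrow>\<^sub>E V" using x(4) by (auto simp: u_def J_def)
    moreover have "v \<in> (J - {Min J}) \<rightarrow>\<^sub>E {1..int n}"
    proof -
      have "x j \<in> {1..int n}" if "j \<in> J" for j using that N by (auto simp: J_def)
      then show ?thesis unfolding v_def by (intro restrict_PiE_iff[THEN iffD2]) auto
    qed
    ultimately have "\<psi> (J, u, v) = x ` J" "(J, u, v) \<in> T" using J by (auto simp: T_def)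
    then show "N \<in> \<psi> ` T" using xJ by (metis imageI)
  qed
  then have "card ?L \<le> card T" by (rule surj_card_le[OF finT])
  then show ?thesis using cT by linarith
qed

section \<open>States of an exploration\<close>

text \<open>The exploration of a hypergraph is recorded in a state \<open>(xs, q, e, f)\<close>: the vertices found so far
in their order of discovery, the position of the vertex that is being processed, the number of
edges found, and how many of these edges were found by a free move (see below).\<close>

type_synonym state = "int list \<times> nat \<times> nat \<times> nat"

locale two_equations =
  fixes a b :: nat and \<alpha> \<beta> :: "nat \<Rightarrow> int"
  assumes a3: "3 \<le> a" and ab: "a \<le> b"
    and \<alpha>0: "\<And>j. j < a \<Longrightarrow> \<alpha> j \<noteq> 0" and \<beta>0: "\<And>j. j < b \<Longrightarrow> \<beta> j \<noteq> 0"
begin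

definition edges :: "int set set" where
  "edges = solution_sets a \<alpha> \<union> solution_sets b \<beta>"

text \<open>In one round of the exploration for \<open>a < b\<close>, a solution of the second equation is added, and then
a solution of the first equation through each of its at most \<open>b\<close> new vertices.  A round therefore
adds at most \<open>b + a * b\<close> vertices, and the vertices to which these solutions are attached lie that
close to the end of the list.\<close>

definition window :: nat where
  "window = b + a * b"

fun advance :: "state \<Rightarrow> state set" where
  "advance (xs, q, e, f) = (if q < length xs then {(xs, Suc q, e, f)} else {})"

text \<open>A forced move adds an edge that meets the known vertices in one vertex only, whose position is
determined up to a bounded number of choices.  Since the known vertex contributes no choice, long
sequences of forced moves can be counted without a factor growing with the number of vertices.\<close>

fun forced :: "int set \<Rightarrow> state \<Rightarrow> state set" where
  "forced U (xs, q, e, f) = {(xs @ sorted_list_of_set N, q, Suc e, f) | N i.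
     N \<subseteq> U \<and> N \<inter> set xs = {} \<and> i < length xs \<and> (i = q \<or> length xs \<le> i + window) \<and> insert (xs ! i) N \<in> edges}"

text \<open>A free move adds an edge that may meet the known vertices anywhere, or nowhere.  There are
polynomially many ways to do so, which is affordable for a bounded number of moves.\<close>

fun free :: "int set \<Rightarrow> state \<Rightarrow> state set" where
  "free U (xs, q, e, f) = {(xs @ sorted_list_of_set N, q, Suc e, Suc f) | N g.
     N \<subseteq> U \<and> N \<noteq> {} \<and> N \<inter> set xs = {} \<and> g \<in> edges \<and> N \<subseteq> g \<and> g - N \<subseteq> set xs}"

definition successors :: "int set \<Rightarrow> state \<Rightarrow> state set" where
  "successors U s = advance s \<union> forced U s \<union> free U s"

fun layer :: "int set \<Rightarrow> nat \<Rightarrow> state set" where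
  "layer U 0 = {([], 0, 0, 0)}"
| "layer U (Suc t) = (\<Union>s\<in>layer U t. successors U s)"

lemma edges_card: "g \<in> edges \<Longrightarrow> finite g \<and> 3 \<le> card g \<and> card g \<le> b"
  using a3 ab solution_sets_card unfolding edges_def by fastforce

lemma finite_successors: "finite U \<Longrightarrow> finite (successors U s)"
proof -
  assume U: "finite U"
  obtain xs q e f where s: "s = (xs, q, e, f)" by (cases s) auto
  have "forced U s \<subseteq> (\<lambda>N. (xs @ sorted_list_of_set N, q, Suc e, f)) ` Pow U" by (auto simp: s)
  moreover have "free U s \<subseteq> (\<lambda>N. (xs @ sorted_list_of_set N, q, Suc e, Suc f)) ` Pow U" by (auto simp: s)
  ultimately have "finite (forced U s)" "finite (free U s)"
    using U by (meson finite_Pow_iff finite_imageI finite_subset)+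
  then show ?thesis by (simp add: successors_def s)
qed

lemma finite_layer: "finite U \<Longrightarrow> finite (layer U t)"
  by (induction t) (auto simp: finite_successors)

lemma successors_props:
  assumes "(xs', q', e', f') \<in> successors U (xs, q, e, f)" "finite U"
    and "distinct xs" "set xs \<subseteq> U" "q \<le> length xs"
  shows "distinct xs' \<and> set xs' \<subseteq> U \<and> q' \<le> length xs' \<and> length xs' \<le> length xs + b"
proof -
  have *: "distinct (xs @ sorted_list_of_set N) \<and> set (xs @ sorted_list_of_set N) \<subseteq> U
      \<and> q \<le> length (xs @ sorted_list_of_set N) \<and> length (xs @ sorted_list_of_set N) \<le> length xs + b"
    if "N \<subseteq> U" "N \<inter> set xs = {}" "N \<subseteq> g" "g \<in> edges" for N g
  proof -
    have "finite N" using that assms finite_subset by blast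
    moreover have "card N \<le> b" using edges_card[OF that(4)] card_mono[of g N] that(3) by auto
    ultimately show ?thesis using that assms by auto
  qed
  from assms(1) consider "xs' = xs \<and> q' = Suc q \<and> q < length xs"
    | N i where "xs' = xs @ sorted_list_of_set N" "q' = q" "N \<subseteq> U" "N \<inter> set xs = {}" "insert (xs ! i) N \<in> edges"
    | N g where "xs' = xs @ sorted_list_of_set N" "q' = q" "N \<subseteq> U" "N \<inter> set xs = {}" "N \<subseteq> g" "g \<in> edges"
    unfolding successors_def by (auto split: if_splits)
  then show ?thesis
  proof cases
    case 1 then show ?thesis using assms by auto
  next
    case (2 N i) then show ?thesis using *[of N "insert (xs ! i) N"] by auto
  next
    case (3 N g) then show ?thesis using *[of N g] by auto
  qed
qed

lemma layer_props:
  assumes "finite U" "(xs, q, e, f) \<in> layer U t"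
  shows "distinct xs \<and> set xs \<subseteq> U \<and> q \<le> length xs \<and> length xs \<le> t * b"
  using assms(2)
proof (induction t arbitrary: xs q e f)
  case (Suc t)
  then obtain xs0 q0 e0 f0 where s: "(xs0, q0, e0, f0) \<in> layer U t" "(xs, q, e, f) \<in> successors U (xs0, q0, e0, f0)"
    by auto
  from successors_props[OF s(2) assms(1)] Suc.IH[OF s(1)] show ?case by auto
qed simp

lemma successors_mono: "V \<subseteq> U \<Longrightarrow> successors V s \<subseteq> successors U s"
proof -
  assume VU: "V \<subseteq> U"
  obtain xs q e f where s: "s = (xs, q, e, f)" by (cases s) auto
  have "forced V s \<subseteq> forced U s" using VU unfolding s by simp blast
  moreover have "free V s \<subseteq> free U s"
  proof
    fix s' assume "s' \<in> free V s"
    then obtain N g where N: "s' = (xs @ sorted_list_of_set N, q, Suc e, Suc f)" "N \<subseteq> V" "N \<noteq> {}"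
      "N \<inter> set xs = {}" "g \<in> edges" "N \<subseteq> g" "g - N \<subseteq> set xs"
      unfolding s free.simps by blast
    have "N \<subseteq> U" using N(2) VU by simp
    with N show "s' \<in> free U s" unfolding s free.simps mem_Collect_eq by (intro exI[of _ N] exI[of _ g] conjI)
  qed
  ultimately show ?thesis unfolding successors_def by blast
qed

text \<open>The exploration runs inside a random set, while the counting runs over \<open>{1..n}\<close>.\<close>

lemma layer_mono: "V \<subseteq> U \<Longrightarrow> layer V t \<subseteq> layer U t"
  by (induction t) (use successors_mono in auto, blast)

definition extensions :: "nat \<Rightarrow> nat \<Rightarrow> (nat \<Rightarrow> int) \<Rightarrow> int set \<Rightarrow> nat \<Rightarrow> int set set" where
  "extensions n k \<gamma> V m = {N. N \<subseteq> {1..int n} \<and> card N = m \<and> (\<exists>g\<in>solution_sets k \<gamma>. N \<subseteq> g \<and> g - N \<subseteq> V)}"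

lemma finite_extensions: "finite (extensions n k \<gamma> V m)"
  by (rule finite_subset[of _ "Pow {1..int n}"]) (auto simp: extensions_def)

text \<open>With \<open>P = 2 * p / n powr y\<close>, the factor \<open>p ^ length xs\<close> is the probability that the vertices of
the state are all present.  The factor \<open>2 ^ length xs * (1 / 2) ^ q \<ge> 1\<close> makes moving the
position \<open>q\<close> forward cost a factor \<open>1 / 2\<close>, so that unboundedly many positions may be skipped; \<open>D\<close> will
be a small negative power of \<open>n\<close> that absorbs the polynomially many choices of a free move.  The
remaining factor \<open>n powr (e - y * length xs)\<close> is inverse to the expected number of such states.\<close>

fun weight :: "nat \<Rightarrow> real \<Rightarrow> real \<Rightarrow> state \<Rightarrow> real" where
  "weight n P D (xs, q, e, f) = P ^ length xs * real n ^ e * D ^ f * (1 / 2) ^ q"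

lemma weight_nonneg: "0 \<le> P \<Longrightarrow> 0 \<le> D \<Longrightarrow> 0 \<le> weight n P D s"
  by (cases s) auto

text \<open>A new edge with \<open>m\<close> new vertices allows about \<open>n ^ (m - 1)\<close> choices and changes the weight by
\<open>P ^ m * n\<close>, so each edge changes the total weight only by the constant \<open>(n * P) ^ m\<close>, which is small
for a small constant in the threshold.\<close>

lemma extensions_weight:
  assumes P: "0 \<le> P" "real n * P \<le> \<kappa>" "\<kappa> \<le> 1" and n: "1 \<le> n"
    and k: "k = a \<and> \<gamma> = \<alpha> \<or> k = b \<and> \<gamma> = \<beta>" and m: "1 \<le> m" "m \<le> k" and V: "finite V"
  shows "(\<Sum>N\<in>extensions n k \<gamma> V m. P ^ card N * real n) \<le> 2 ^ b * real (card V) ^ (k - m) * \<kappa>"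
proof -
  have \<gamma>: "\<And>j. j < k \<Longrightarrow> \<gamma> j \<noteq> 0" using k \<alpha>0 \<beta>0 by auto
  have kb: "k \<le> b" using k ab by auto
  have "(\<Sum>N\<in>extensions n k \<gamma> V m. P ^ card N * real n) = real (card (extensions n k \<gamma> V m)) * (P ^ m * real n)"
    by (simp add: extensions_def)
  also have "\<dots> \<le> real (2 ^ k * card V ^ (k - m) * n ^ (m - 1)) * (P ^ m * real n)"
    using card_extensions[where k = k and \<alpha> = \<gamma> and V = V and n = n, OF \<gamma> V m] P(1)
    unfolding extensions_def by (intro mult_right_mono of_nat_mono) auto
  also have "\<dots> = 2 ^ k * real (card V) ^ (k - m) * (P * real n) ^ m"
    using m by (cases m) (auto simp: power_mult_distrib)
  also have "\<dots> \<le> 2 ^ b * real (card V) ^ (k - m) * \<kappa>"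
  proof -
    have "(P * real n) ^ m \<le> (P * real n) ^ 1"
      using P m by (intro power_decreasing) (auto simp: mult.commute)
    also have "\<dots> \<le> \<kappa>" using P by (simp add: mult.commute)
    finally have "(P * real n) ^ m \<le> \<kappa>" .
    moreover have "(2::real) ^ k \<le> 2 ^ b" using kb by (intro power_increasing) auto
    ultimately show ?thesis using P by (intro mult_mono) auto
  qed
  finally show ?thesis .
qed

end

section \<open>The first moment of explorations\<close>

lemma sum_Un_le:
  fixes h :: "'x \<Rightarrow> real"
  assumes "finite A" "finite B" "\<And>x. 0 \<le> h x"
  shows "sum h (A \<union> B) \<le> sum h A + sum h B"
  using sum.union_inter[OF assms(1,2), of h] sum_nonneg[of "A \<inter> B" h] assms(3) by simp

lemma sum_UN_le:
  fixes h :: "'x \<Rightarrow> real"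
  assumes "finite I" "\<And>i. i \<in> I \<Longrightarrow> finite (A i)" "\<And>x. 0 \<le> h x"
  shows "sum h (\<Union>i\<in>I. A i) \<le> (\<Sum>i\<in>I. sum h (A i))"
  using assms(1,2)
proof (induction I rule: finite_induct)
  case (insert i I)
  have "sum h (\<Union>i\<in>insert i I. A i) \<le> sum h (A i) + sum h (\<Union>i\<in>I. A i)"
    using sum_Un_le[of "A i" "\<Union>i\<in>I. A i" h] insert assms(3) by simp
  then show ?case using insert by fastforce
qed simp

lemma sum_cover_le:
  fixes h :: "'x \<Rightarrow> real"
  assumes "finite I" "\<And>i. i \<in> I \<Longrightarrow> finite (A i)" "\<And>x. 0 \<le> h x" "S \<subseteq> (\<Union>i\<in>I. A i)"
    and "\<And>i. i \<in> I \<Longrightarrow> sum h (A i) \<le> c" "0 \<le> c" "card I \<le> d"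
  shows "sum h S \<le> real d * c"
proof -
  have "sum h S \<le> sum h (\<Union>i\<in>I. A i)"
    using assms(1-4) by (intro sum_mono2) auto
  also have "\<dots> \<le> (\<Sum>i\<in>I. sum h (A i))" by (rule sum_UN_le[OF assms(1-3)])
  also have "\<dots> \<le> real (card I) * c" using assms(5) by (rule sum_bounded_above)
  also have "\<dots> \<le> real d * c" using assms(6,7) by (intro mult_right_mono) auto
  finally show ?thesis .
qed

context two_equations
begin

lemma weight_append:
  "finite N \<Longrightarrow> weight n P D (xs @ sorted_list_of_set N, q, Suc e, f) = weight n P D (xs, q, e, f) * (P ^ card N * real n)"
  by (simp add: power_add)

lemma weight_append_free:
  "finite N \<Longrightarrow> weight n P D (xs @ sorted_list_of_set N, q, Suc e, Suc f)
     = weight n P D (xs, q, e, f) * D * (P ^ card N * real n)"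
  by (simp add: power_add)

text \<open>Advancing, forced moves and free moves contribute at most \<open>1 / 2\<close>, \<open>1 / 8\<close> and \<open>1 / 8\<close> of the
weight of the current state.\<close>

lemma successors_weight:
  assumes P: "0 \<le> P" "real n * P \<le> \<kappa>" "\<kappa> \<le> 1" and n: "1 \<le> n" and D: "0 \<le> D"
    and c1: "2 * (real window + 1) * 2 ^ b * \<kappa> \<le> 1 / 8"
    and c2: "2 * real b * 2 ^ b * (real L + 1) ^ b * D \<le> 1 / 8"
    and xs: "length xs \<le> L"
  shows "(\<Sum>s\<in>successors {1..int n} (xs, q, e, f). weight n P D s) \<le> 3 / 4 * weight n P D (xs, q, e, f)"
proof -
  define W where "W = weight n P D (xs, q, e, f)"
  let ?h = "weight n P D" and ?U = "{1..int n}"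
  have h: "0 \<le> ?h s" for s using P D by (rule_tac weight_nonneg) auto
  have W: "0 \<le> W" unfolding W_def by (rule h)
  have \<kappa>: "0 \<le> \<kappa>" using P n by (meson mult_nonneg_nonneg of_nat_0_le_iff order_trans)
  define K where "K = {(a, \<alpha>), (b, \<beta>)}"
  have K: "finite K" "card K \<le> 2" unfolding K_def by (auto simp: card_insert_if)
  have Kk: "k = a \<and> \<gamma> = \<alpha> \<or> k = b \<and> \<gamma> = \<beta>" "3 \<le> k" "k \<le> b" if "(k, \<gamma>) \<in> K" for k \<gamma>
    using that a3 ab by (auto simp: K_def)
  have finN: "finite N" if "N \<in> extensions n k \<gamma> V m" for N k \<gamma> V m
    using that unfolding extensions_def by (auto intro: finite_subset)
  have "sum ?h (advance (xs, q, e, f)) \<le> 1 / 2 * W"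
    using P(1) D by (auto simp: W_def intro!: mult_nonneg_nonneg)
  moreover have "sum ?h (forced ?U (xs, q, e, f)) \<le> 1 / 8 * W"
  proof -
    define I where "I = {i. i < length xs \<and> (i = q \<or> length xs \<le> i + window)}"
    have "I \<subseteq> insert q {length xs - window..<length xs}" by (auto simp: I_def)
    then have "card I \<le> card (insert q {length xs - window..<length xs})" by (intro card_mono) auto
    also have "\<dots> \<le> Suc (card {length xs - window..<length xs})" by (rule card_insert_le_m1) auto
    also have "\<dots> \<le> window + 1" by simp
    finally have I: "finite I" "card I \<le> window + 1" by (auto simp: I_def)
    define A where "A = (\<lambda>(i, k, \<gamma>). (\<lambda>N. (xs @ sorted_list_of_set N, q, Suc e, f)) ` extensions n k \<gamma> {xs ! i} (k - 1))"
    have "sum ?h (forced ?U (xs, q, e, f)) \<le> real ((window + 1) * 2) * (W * (2 ^ b * \<kappa>))"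
    proof (rule sum_cover_le[where I = "I \<times> K" and A = A])
      show "finite (I \<times> K)" using I K by simp
      show "finite (A i)" for i by (cases i) (auto simp: A_def finite_extensions)
      show "0 \<le> ?h s" for s by (rule h)
      show "card (I \<times> K) \<le> (window + 1) * 2" using mult_le_mono[OF I(2) K(2)] unfolding card_cartesian_product .
      show "0 \<le> W * (2 ^ b * \<kappa>)" using W \<kappa> by simp
      show "forced ?U (xs, q, e, f) \<subseteq> (\<Union>i\<in>I \<times> K. A i)"
      proof
        fix s assume "s \<in> forced ?U (xs, q, e, f)"
        then obtain N i where N: "s = (xs @ sorted_list_of_set N, q, Suc e, f)" "N \<subseteq> ?U" "N \<inter> set xs = {}"
          "i < length xs" "i = q \<or> length xs \<le> i + window" "insert (xs ! i) N \<in> edges" by auto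
        then obtain k \<gamma> where k: "(k, \<gamma>) \<in> K" "insert (xs ! i) N \<in> solution_sets k \<gamma>"
          unfolding edges_def K_def by blast
        have "xs ! i \<notin> N" using N(3,4) nth_mem by blast
        moreover have "finite N" using N(2) by (auto intro: finite_subset)
        ultimately have "card N = k - 1" using solution_sets_card[OF k(2)] by auto
        then have "N \<in> extensions n k \<gamma> {xs ! i} (k - 1)" using N k unfolding extensions_def by blast
        then have "s \<in> A (i, k, \<gamma>)" unfolding A_def N(1) by auto
        moreover have "i \<in> I" using N by (auto simp: I_def)
        ultimately show "s \<in> (\<Union>i\<in>I \<times> K. A i)" using k(1) by blast
      qed
      show "sum ?h (A x) \<le> W * (2 ^ b * \<kappa>)" if "x \<in> I \<times> K" for x
      proof -
        obtain i k \<gamma> where x: "x = (i, k, \<gamma>)" by (cases x) auto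
        have k: "(k, \<gamma>) \<in> K" using that x by auto
        have "sum ?h (A x) \<le> (\<Sum>N\<in>extensions n k \<gamma> {xs ! i} (k - 1). ?h (xs @ sorted_list_of_set N, q, Suc e, f))"
          unfolding x A_def using sum_image_le[OF finite_extensions, where g = ?h] h by (simp add: o_def del: weight.simps)
        also have "\<dots> = (\<Sum>N\<in>extensions n k \<gamma> {xs ! i} (k - 1). W * (P ^ card N * real n))"
          unfolding W_def by (intro sum.cong refl weight_append finN)
        also have "\<dots> = W * (\<Sum>N\<in>extensions n k \<gamma> {xs ! i} (k - 1). P ^ card N * real n)"
          by (simp add: sum_distrib_left)
        also have "\<dots> \<le> W * (2 ^ b * \<kappa>)"
          using extensions_weight[OF P n Kk(1)[OF k], of "k - 1" "{xs ! i}"] Kk(2)[OF k] W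
          by (intro mult_left_mono) auto
        finally show ?thesis .
      qed
    qed
    also have "\<dots> = (2 * (real window + 1) * 2 ^ b * \<kappa>) * W" by (simp add: algebra_simps)
    also have "\<dots> \<le> 1 / 8 * W" using c1 W by (rule mult_right_mono)
    finally show ?thesis .
  qed
  moreover have "sum ?h (free ?U (xs, q, e, f)) \<le> 1 / 8 * W"
  proof -
    define A where "A = (\<lambda>(m, k, \<gamma>). (\<lambda>N. (xs @ sorted_list_of_set N, q, Suc e, Suc f)) `
                       (if m \<le> k then extensions n k \<gamma> (set xs) m else {}))"
    have "sum ?h (free ?U (xs, q, e, f)) \<le> real (b * 2) * (W * D * (2 ^ b * (real L + 1) ^ b))"
    proof (rule sum_cover_le[where I = "{1..b} \<times> K" and A = A])
      show "finite ({1..b} \<times> K)" using K by simp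
      show "finite (A i)" for i by (cases i) (auto simp: A_def finite_extensions)
      show "0 \<le> ?h s" for s by (rule h)
      show "card ({1..b} \<times> K) \<le> b * 2" using mult_le_mono2[OF K(2), of b] by (simp add: card_cartesian_product)
      show "0 \<le> W * D * (2 ^ b * (real L + 1) ^ b)" using W D by simp
      show "free ?U (xs, q, e, f) \<subseteq> (\<Union>i\<in>{1..b} \<times> K. A i)"
      proof
        fix s assume "s \<in> free ?U (xs, q, e, f)"
        then obtain N g where N: "s = (xs @ sorted_list_of_set N, q, Suc e, Suc f)" "N \<subseteq> ?U" "N \<noteq> {}"
          "N \<inter> set xs = {}" "g \<in> edges" "N \<subseteq> g" "g - N \<subseteq> set xs" by auto
        then obtain k \<gamma> where k: "(k, \<gamma>) \<in> K" "g \<in> solution_sets k \<gamma>"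
          unfolding edges_def K_def by blast
        have "finite N" using N(2) by (auto intro: finite_subset)
        then have "1 \<le> card N" using N(3) by (simp add: Suc_leI card_gt_0_iff)
        moreover have "card N \<le> k" using solution_sets_card[OF k(2)] N(6) card_mono by blast
        moreover have "N \<in> extensions n k \<gamma> (set xs) (card N)" using N k unfolding extensions_def by blast
        ultimately have "s \<in> A (card N, k, \<gamma>)" "card N \<in> {1..b}" using Kk(3)[OF k(1)] unfolding A_def N(1) by auto
        then show "s \<in> (\<Union>i\<in>{1..b} \<times> K. A i)" using k(1) by blast
      qed
      show "sum ?h (A x) \<le> W * D * (2 ^ b * (real L + 1) ^ b)" if "x \<in> {1..b} \<times> K" for x
      proof -
        obtain m k \<gamma> where x: "x = (m, k, \<gamma>)" by (cases x) auto
        have k: "(k, \<gamma>) \<in> K" and m: "1 \<le> m" using that x by auto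
        show ?thesis
        proof (cases "m \<le> k")
          case True
          let ?E = "extensions n k \<gamma> (set xs) m"
          have "sum ?h (A x) \<le> (\<Sum>N\<in>?E. ?h (xs @ sorted_list_of_set N, q, Suc e, Suc f))"
            unfolding x A_def using sum_image_le[OF finite_extensions, where g = ?h] h True by (simp add: o_def del: weight.simps)
          also have "\<dots> = (\<Sum>N\<in>?E. W * D * (P ^ card N * real n))"
            unfolding W_def by (intro sum.cong refl weight_append_free finN)
          also have "\<dots> = W * D * (\<Sum>N\<in>?E. P ^ card N * real n)"
            by (simp add: sum_distrib_left)
          also have "\<dots> \<le> W * D * (2 ^ b * real (card (set xs)) ^ (k - m) * \<kappa>)"
            using extensions_weight[OF P n Kk(1)[OF k] m True, of "set xs"] W D
            by (intro mult_left_mono) auto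
          also have "\<dots> \<le> W * D * (2 ^ b * (real L + 1) ^ b)"
          proof -
            have "card (set xs) \<le> L" using xs card_length order_trans by blast
            then have "real (card (set xs)) ^ (k - m) \<le> (real L + 1) ^ (k - m)" by (intro power_mono) auto
            also have "\<dots> \<le> (real L + 1) ^ b" using Kk(3)[OF k] by (intro power_increasing) auto
            finally have "real (card (set xs)) ^ (k - m) * \<kappa> \<le> (real L + 1) ^ b * 1"
              using P(3) \<kappa> by (intro mult_mono) auto
            then have "2 ^ b * real (card (set xs)) ^ (k - m) * \<kappa> \<le> 2 ^ b * (real L + 1) ^ b" by simp
            then show ?thesis using W D by (intro mult_left_mono) auto
          qed
          finally show ?thesis .
        next
          case False then show ?thesis using W D by (simp add: x A_def)
        qed
      qed
    qed
    also have "\<dots> = (2 * real b * 2 ^ b * (real L + 1) ^ b * D) * W" by (simp add: algebra_simps)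
    also have "\<dots> \<le> 1 / 8 * W" using c2 W by (rule mult_right_mono)
    finally show ?thesis .
  qed
  moreover have "sum ?h (successors ?U (xs, q, e, f))
      \<le> sum ?h (advance (xs, q, e, f)) + sum ?h (forced ?U (xs, q, e, f)) + sum ?h (free ?U (xs, q, e, f))"
  proof -
    have "finite (successors ?U (xs, q, e, f))" by (rule finite_successors) simp
    then have "finite (forced ?U (xs, q, e, f))" "finite (free ?U (xs, q, e, f))" "finite (advance (xs, q, e, f))"
      by (auto simp: successors_def)
    then show ?thesis
      using sum_Un_le[of "advance (xs, q, e, f) \<union> forced ?U (xs, q, e, f)" "free ?U (xs, q, e, f)" ?h]
        sum_Un_le[of "advance (xs, q, e, f)" "forced ?U (xs, q, e, f)" ?h] h
      unfolding successors_def by fastforce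
  qed
  ultimately show ?thesis by (simp add: W_def)
qed

text \<open>The total weight decays geometrically along the exploration: the branching process of forced
moves is subcritical.\<close>

lemma layer_weight:
  assumes P: "0 \<le> P" "real n * P \<le> \<kappa>" "\<kappa> \<le> 1" and n: "1 \<le> n" and D: "0 \<le> D"
    and c1: "2 * (real window + 1) * 2 ^ b * \<kappa> \<le> 1 / 8"
    and c2: "2 * real b * 2 ^ b * (real L + 1) ^ b * D \<le> 1 / 8"
    and t: "t * b \<le> L"
  shows "(\<Sum>s\<in>layer {1..int n} t. weight n P D s) \<le> (3 / 4) ^ t"
  using t
proof (induction t)
  case (Suc t)
  let ?h = "weight n P D" and ?U = "{1..int n}"
  have h: "0 \<le> ?h s" for s using P D by (rule_tac weight_nonneg) auto
  have "sum ?h (layer ?U (Suc t)) \<le> (\<Sum>s\<in>layer ?U t. sum ?h (successors ?U s))"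
    by (simp del: weight.simps, rule sum_UN_le) (auto simp: finite_layer finite_successors h)
  also have "\<dots> \<le> (\<Sum>s\<in>layer ?U t. 3 / 4 * ?h s)"
  proof (rule sum_mono)
    fix s assume s: "s \<in> layer ?U t"
    obtain xs q e f where s': "s = (xs, q, e, f)" by (cases s) auto
    have "length xs \<le> t * b" using layer_props[of ?U xs q e f t] s s' by auto
    then have "length xs \<le> L" using Suc.prems by simp
    then show "sum ?h (successors ?U s) \<le> 3 / 4 * ?h s"
      unfolding s' by (rule successors_weight[OF P n D c1 c2])
  qed
  also have "\<dots> = 3 / 4 * sum ?h (layer ?U t)" by (simp add: sum_distrib_left)
  also have "\<dots> \<le> (3 / 4) ^ Suc t" using Suc by simp
  finally show ?case .
qed simp

end

lemma prob_random_subset_superset: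
  assumes p: "0 \<le> p" "p \<le> 1" and X: "X \<subseteq> {1..int n}"
  shows "measure_pmf.prob (random_subset n p) {S. X \<subseteq> S} = p ^ card X"
proof -
  let ?A = "{1..int n}" and ?B = "\<lambda>x. if x \<in> X then {True} else UNIV"
  have "measure_pmf.prob (random_subset n p) {S. X \<subseteq> S}
      = measure_pmf.prob (Pi_pmf ?A False (\<lambda>_. bernoulli_pmf p)) (Pi ?A ?B)"
    unfolding random_subset_def measure_map_pmf using X
    by (intro arg_cong[of _ _ "measure_pmf.prob _"]) (auto simp: Pi_def subset_iff split: if_splits)
  also have "\<dots> = (\<Prod>x\<in>?A. measure_pmf.prob (bernoulli_pmf p) (?B x))"
    by (rule measure_Pi_pmf_Pi) simp
  also have "\<dots> = (\<Prod>x\<in>?A. if x \<in> X then p else 1)"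
    using p by (intro prod.cong) (auto simp: measure_pmf_single)
  also have "\<dots> = (\<Prod>x\<in>X. p)"
    using X by (subst prod.If_cases) (auto simp: Int_absorb1)
  finally show ?thesis by simp
qed

lemma random_subset_subset: "S \<in> set_pmf (random_subset n p) \<Longrightarrow> S \<subseteq> {1..int n}"
  by (auto simp: random_subset_def)

lemma prob_random_subset_some_superset:
  assumes p: "0 \<le> p" "p \<le> 1" and Q: "finite Q" "\<And>s. s \<in> Q \<Longrightarrow> V s \<subseteq> {1..int n}"
  shows "measure_pmf.prob (random_subset n p) {S. \<exists>s\<in>Q. V s \<subseteq> S} \<le> (\<Sum>s\<in>Q. p ^ card (V s))"
proof -
  have "{S. \<exists>s\<in>Q. V s \<subseteq> S} = (\<Union>s\<in>Q. {S. V s \<subseteq> S})" by auto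
  then have "measure_pmf.prob (random_subset n p) {S. \<exists>s\<in>Q. V s \<subseteq> S}
      \<le> (\<Sum>s\<in>Q. measure_pmf.prob (random_subset n p) {S. V s \<subseteq> S})"
    using Q(1) by (auto intro!: measure_pmf.finite_measure_subadditive_finite)
  also have "\<dots> = (\<Sum>s\<in>Q. p ^ card (V s))"
    using prob_random_subset_superset[OF p] Q(2) by (intro sum.cong) auto
  finally show ?thesis .
qed

section \<open>Critical pairs of hypergraphs\<close>

text \<open>Here \<open>D\<close> is the first colour class and its complement the second; edges in \<open>P\<close> must not have the
first colour, edges in \<open>Q\<close> not the second.\<close>

definition uncolourable :: "'v set set \<Rightarrow> 'v set set \<Rightarrow> bool" where
  "uncolourable P Q \<longleftrightarrow> (\<forall>D. (\<exists>g\<in>P. g \<subseteq> D) \<or> (\<exists>h\<in>Q. h \<inter> D = {}))"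

definition critical :: "'v set set \<Rightarrow> 'v set set \<Rightarrow> bool" where
  "critical P Q \<longleftrightarrow> uncolourable P Q \<and>
     (\<forall>P' Q'. P' \<subseteq> P \<longrightarrow> Q' \<subseteq> Q \<longrightarrow> uncolourable P' Q' \<longrightarrow> P' = P \<and> Q' = Q)"

lemma uncolourable_swap: "uncolourable P Q \<Longrightarrow> uncolourable Q P"
  unfolding uncolourable_def
proof
  fix D assume *: "\<forall>D. (\<exists>g\<in>P. g \<subseteq> D) \<or> (\<exists>h\<in>Q. h \<inter> D = {})"
  have "(\<exists>g\<in>P. g \<subseteq> - D) \<or> (\<exists>h\<in>Q. h \<inter> (- D) = {})" using * by blast
  then show "(\<exists>g\<in>Q. g \<subseteq> D) \<or> (\<exists>h\<in>P. h \<inter> D = {})" by blast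
qed

lemma critical_swap: "critical P Q \<Longrightarrow> critical Q P"
  unfolding critical_def by (meson uncolourable_swap)

lemma critical_exists:
  assumes "finite P" "finite Q" "uncolourable P Q"
  shows "\<exists>P' Q'. P' \<subseteq> P \<and> Q' \<subseteq> Q \<and> critical P' Q'"
  using assms
proof (induction "card P + card Q" arbitrary: P Q rule: less_induct)
  case less
  show ?case
  proof (cases "critical P Q")
    case False
    then obtain P' Q' where *: "P' \<subseteq> P" "Q' \<subseteq> Q" "uncolourable P' Q'" "\<not> (P' = P \<and> Q' = Q)"
      using less.prems unfolding critical_def by blast
    have less': "card P' + card Q' < card P + card Q"
    proof (cases "P' = P")
      case True
      then have "Q' \<subset> Q" using * by blast
      then show ?thesis using True psubset_card_mono[OF less.prems(2)] by simp
    next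
      case False
      then have "P' \<subset> P" using * by blast
      then have "card P' < card P" by (rule psubset_card_mono[OF less.prems(1)])
      moreover have "card Q' \<le> card Q" by (rule card_mono[OF less.prems(2) *(2)])
      ultimately show ?thesis by simp
    qed
    have "finite P'" "finite Q'" using finite_subset[OF *(1)] finite_subset[OF *(2)] less.prems by simp_all
    from less.hyps[OF less' this *(3)]
    obtain P'' Q'' where "P'' \<subseteq> P'" "Q'' \<subseteq> Q'" "critical P'' Q''" by (elim exE conjE)
    then show ?thesis using *(1,2) by (rule_tac exI[of _ P''], rule_tac exI[of _ Q'']) auto
  qed blast
qed

lemma critical_minimal:
  "critical P Q \<Longrightarrow> uncolourable P' Q' \<Longrightarrow> P' \<subseteq> P \<Longrightarrow> Q' \<subseteq> Q \<Longrightarrow> P' = P \<and> Q' = Q"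
  by (simp add: critical_def)

text \<open>By minimality some colouring spoils the edge \<open>e\<close> and nothing else.  Changing the colour of \<open>v\<close>
repairs \<open>e\<close>, so it must spoil an edge \<open>h\<close> of the other family; all of \<open>h\<close> except \<open>v\<close> has the
second colour and all of \<open>e\<close> the first one, so they meet in \<open>v\<close> only.\<close>

lemma critical_crossing:
  assumes "critical P Q" "e \<in> P" "v \<in> e"
  shows "\<exists>h\<in>Q. e \<inter> h = {v}"
proof -
  have "\<not> uncolourable (P - {e}) Q" using critical_minimal[OF assms(1), of "P - {e}" Q] assms(2) by blast
  then have "\<exists>D. \<not> ((\<exists>g\<in>P - {e}. g \<subseteq> D) \<or> (\<exists>h\<in>Q. h \<inter> D = {}))"
    unfolding uncolourable_def by (simp only: not_all)
  then obtain D where "\<not> ((\<exists>g\<in>P - {e}. g \<subseteq> D) \<or> (\<exists>h\<in>Q. h \<inter> D = {}))" ..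
  then have D: "\<And>g. g \<in> P \<Longrightarrow> g \<noteq> e \<Longrightarrow> \<not> g \<subseteq> D" "\<And>h. h \<in> Q \<Longrightarrow> h \<inter> D \<noteq> {}"
    by simp_all
  have unc: "(\<exists>g\<in>P. g \<subseteq> D) \<or> (\<exists>h\<in>Q. h \<inter> D = {})" for D
    using assms(1) by (simp add: critical_def uncolourable_def)
  have eD: "e \<subseteq> D" using unc[of D] D by blast
  from unc[of "D - {v}"] show ?thesis
  proof
    assume "\<exists>g\<in>P. g \<subseteq> D - {v}"
    then show ?thesis using D(1) assms(3) by blast
  next
    assume "\<exists>h\<in>Q. h \<inter> (D - {v}) = {}"
    then obtain h where h: "h \<in> Q" "h \<inter> (D - {v}) = {}" by blast
    then have "e \<inter> h = {v}" using D(2)[OF h(1)] eD assms(3) by blast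
    then show ?thesis using h by blast
  qed
qed

lemma critical_crossing_union:
  assumes "critical P Q" "g \<in> P \<union> Q" "v \<in> g"
  shows "\<exists>h\<in>P \<union> Q. g \<inter> h = {v}"
proof (cases "g \<in> P")
  case True
  from critical_crossing[OF assms(1) True assms(3)] obtain h where "h \<in> Q" "g \<inter> h = {v}" by (rule bexE)
  then show ?thesis by (intro bexI[of _ h]) simp_all
next
  case False
  then have "g \<in> Q" using assms(2) by simp
  from critical_crossing[OF critical_swap[OF assms(1)] this assms(3)]
  obtain h where "h \<in> P" "g \<inter> h = {v}" by (rule bexE)
  then show ?thesis by (intro bexI[of _ h]) simp_all
qed

text \<open>If \<open>X\<close> is a union of components, the edges outside \<open>X\<close> can be coloured by minimality, and \<open>C\<close>
extends such a colouring to \<open>X\<close>.\<close>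

lemma critical_component_not_bicolourable:
  assumes "critical P Q" "\<And>g. g \<in> P \<union> Q \<Longrightarrow> g \<inter> X \<noteq> {} \<Longrightarrow> g \<subseteq> X" "C \<subseteq> X"
    and "\<And>g. g \<in> P \<union> Q \<Longrightarrow> g \<subseteq> X \<Longrightarrow> g \<inter> C \<noteq> {} \<and> \<not> g \<subseteq> C"
  shows "\<not> (\<exists>g\<in>P \<union> Q. g \<subseteq> X)"
proof
  assume *: "\<exists>g\<in>P \<union> Q. g \<subseteq> X"
  define P' where "P' = {g \<in> P. \<not> g \<subseteq> X}"
  define Q' where "Q' = {g \<in> Q. \<not> g \<subseteq> X}"
  have "\<not> uncolourable P' Q'"
  proof
    assume "uncolourable P' Q'"
    moreover have "P' \<subseteq> P" "Q' \<subseteq> Q" by (auto simp: P'_def Q'_def)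
    ultimately have "P' = P \<and> Q' = Q" using critical_minimal[OF assms(1)] by simp
    then show False using * unfolding P'_def Q'_def by blast
  qed
  then have "\<exists>D. \<not> ((\<exists>g\<in>P'. g \<subseteq> D) \<or> (\<exists>h\<in>Q'. h \<inter> D = {}))"
    unfolding uncolourable_def by (simp only: not_all)
  then obtain D where "\<not> ((\<exists>g\<in>P'. g \<subseteq> D) \<or> (\<exists>h\<in>Q'. h \<inter> D = {}))" ..
  then have D: "\<And>g. g \<in> P' \<Longrightarrow> \<not> g \<subseteq> D" "\<And>h. h \<in> Q' \<Longrightarrow> h \<inter> D \<noteq> {}"
    by simp_all
  define D' where "D' = (D - X) \<union> C"
  have "(\<exists>g\<in>P. g \<subseteq> D') \<or> (\<exists>h\<in>Q. h \<inter> D' = {})"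
    using assms(1) by (simp add: critical_def uncolourable_def)
  then show False
  proof
    assume "\<exists>g\<in>P. g \<subseteq> D'"
    then obtain g where g: "g \<in> P" "g \<subseteq> D'" by blast
    show False
    proof (cases "g \<subseteq> X")
      case True
      then have "g \<subseteq> C" using g by (auto simp: D'_def)
      then show False using assms(4)[of g] g True by blast
    next
      case False
      then have "g \<inter> X = {}" using assms(2)[of g] g by blast
      then have "g \<subseteq> D" using g assms(3) by (auto simp: D'_def)
      then show False using D(1)[of g] g False by (auto simp: P'_def)
    qed
  next
    assume "\<exists>h\<in>Q. h \<inter> D' = {}"
    then obtain h where h: "h \<in> Q" "h \<inter> D' = {}" by blast
    show False
    proof (cases "h \<subseteq> X")
      case True
      then show False using assms(4)[of h] h by (auto simp: D'_def)
    next
      case False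
      then have "h \<inter> X = {}" using assms(2)[of h] h by blast
      then have "h \<inter> D = {}" using h by (auto simp: D'_def)
      then show False using D(2)[of h] h False by (auto simp: Q'_def)
    qed
  qed
qed

section \<open>Potential of an exploration\<close>

text \<open>The form in which explorations are run: an invariant that can always be propagated by a bounded
number of steps and cannot survive until time \<open>T\<close> must reach a final state before.\<close>

lemma run_until_final:
  fixes Inv :: "nat \<Rightarrow> 's \<Rightarrow> bool"
  assumes "Inv t0 s0" "t0 \<le> T + d"
    and step: "\<And>t s. Inv t s \<Longrightarrow> t < T \<Longrightarrow> \<not> final s \<Longrightarrow> \<exists>t' s'. Inv t' s' \<and> t < t' \<and> t' \<le> t + d"
    and long: "\<And>t s. Inv t s \<Longrightarrow> T \<le> t \<Longrightarrow> t \<le> T + d \<Longrightarrow> False"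
  shows "\<exists>t s. t < T \<and> Inv t s \<and> final s"
  using assms(1,2)
proof (induction "T - t0" arbitrary: t0 s0 rule: less_induct)
  case less
  have t: "t0 < T" using long[OF less.prems(1)] less.prems(2) by force
  show ?case
  proof (cases "final s0")
    case True then show ?thesis using less.prems t by blast
  next
    case False
    from step[OF less.prems(1) t this] obtain t' s' where s': "Inv t' s'" "t0 < t'" "t' \<le> t0 + d" by blast
    show ?thesis using less.hyps[OF _ s'(1)] s' t by auto
  qed
qed

context two_equations
begin

text \<open>A state with \<open>v\<close> vertices and \<open>e\<close> edges is expected about \<open>n powr (y * v - e)\<close> times, where
\<open>y = b / (a * (b - 1))\<close>.  The potential is this exponent multiplied by \<open>a * (b - 1)\<close>, which makes
it an integer.  A single solution of the first equation has potential \<open>a\<close>; attaching a solution of the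
second equation by one vertex, and disjoint solutions of the first one to its other vertices,
leaves the potential unchanged; any further coincidence lowers it.\<close>

fun potential :: "state \<Rightarrow> int" where
  "potential (xs, q, e, f) = int b * int (length xs) - int a * (int b - 1) * int e"

text \<open>A generous bound: for \<open>a < b\<close> the potential limits the number of free moves to \<open>a + 1\<close> at the end of
each round, and at most \<open>b + 2\<close> further ones are made after that; for \<open>a = b\<close> a handful is enough.\<close>

definition max_free :: nat where
  "max_free = a + 2 * b + 5"

text \<open>The event to which the first moment bound applies: an exploration finds a configuration that is too
dense to be expected, or it goes on for too long.  The bound \<open>2 * T\<close> leaves room for completing what
was begun before time \<open>T\<close>.\<close>

definition unlikely :: "int set \<Rightarrow> nat \<Rightarrow> bool" where
  "unlikely S T \<longleftrightarrow> (\<exists>t xs q e f. (xs, q, e, f) \<in> layer S t \<and> t \<le> 2 * T \<and> f \<le> max_free \<and>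
     (potential (xs, q, e, f) < 0 \<or> T \<le> t \<and> potential (xs, q, e, f) \<le> int a))"

lemma unlikelyI:
  "(xs, q, e, f) \<in> layer S t \<Longrightarrow> t \<le> 2 * T \<Longrightarrow> f \<le> max_free \<Longrightarrow> potential (xs, q, e, f) < 0 \<Longrightarrow> unlikely S T"
  "(xs, q, e, f) \<in> layer S t \<Longrightarrow> t \<le> 2 * T \<Longrightarrow> f \<le> max_free \<Longrightarrow> T \<le> t \<Longrightarrow> potential (xs, q, e, f) \<le> int a \<Longrightarrow> unlikely S T"
  unfolding unlikely_def by blast+

lemma free_step:
  assumes "(xs, q, e, f) \<in> layer S t" "g \<in> edges" "g \<subseteq> S" "\<not> g \<subseteq> set xs" "N = g - set xs"
  shows "(xs @ sorted_list_of_set N, q, Suc e, Suc f) \<in> layer S (Suc t)"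
    and "potential (xs @ sorted_list_of_set N, q, Suc e, Suc f)
           = potential (xs, q, e, f) + int b * int (card N) - int a * (int b - 1)"
    and "set (xs @ sorted_list_of_set N) = set xs \<union> g"
proof -
  have fin: "finite N" using edges_card assms by auto
  have "(xs @ sorted_list_of_set N, q, Suc e, Suc f) \<in> free S (xs, q, e, f)"
    unfolding free.simps mem_Collect_eq using assms by (intro exI[of _ N] exI[of _ g]) auto
  then show "(xs @ sorted_list_of_set N, q, Suc e, Suc f) \<in> layer S (Suc t)"
    using assms(1) unfolding layer.simps successors_def by blast
  show "potential (xs @ sorted_list_of_set N, q, Suc e, Suc f)
           = potential (xs, q, e, f) + int b * int (card N) - int a * (int b - 1)"
    by (simp add: algebra_simps)
  show "set (xs @ sorted_list_of_set N) = set xs \<union> g" using fin assms(5) by auto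
qed

lemma forced_step:
  assumes "(xs, q, e, f) \<in> layer S t" "g \<in> edges" "g \<subseteq> S" "g \<inter> set xs = {xs ! i}" "N = g - set xs"
    and "i < length xs" "i = q \<or> length xs \<le> i + window"
  shows "(xs @ sorted_list_of_set N, q, Suc e, f) \<in> layer S (Suc t)"
    and "potential (xs @ sorted_list_of_set N, q, Suc e, f)
           = potential (xs, q, e, f) + int b * int (card g - 1) - int a * (int b - 1)"
    and "set (xs @ sorted_list_of_set N) = set xs \<union> g"
proof -
  have fin: "finite N" "finite g" using edges_card assms by auto
  have g: "insert (xs ! i) N = g" using assms by auto
  have "card N = card g - 1" using g fin by (metis DiffE assms(4,5) card_Diff_singleton_if
        card_insert_disjoint diff_Suc_1 IntD2 insertI1)
  have "(xs @ sorted_list_of_set N, q, Suc e, f) \<in> forced S (xs, q, e, f)"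
    unfolding forced.simps mem_Collect_eq using assms g by (intro exI[of _ N] exI[of _ i]) auto
  then show "(xs @ sorted_list_of_set N, q, Suc e, f) \<in> layer S (Suc t)"
    using assms(1) unfolding layer.simps successors_def by blast
  show "potential (xs @ sorted_list_of_set N, q, Suc e, f)
           = potential (xs, q, e, f) + int b * int (card g - 1) - int a * (int b - 1)"
    using \<open>card N = card g - 1\<close> by (simp add: algebra_simps)
  show "set (xs @ sorted_list_of_set N) = set xs \<union> g" using fin assms(5) by auto
qed

lemma advance_step:
  assumes "(xs, q, e, f) \<in> layer S t" "q < length xs"
  shows "(xs, Suc q, e, f) \<in> layer S (Suc t)"
  using assms unfolding layer.simps successors_def by fastforce

text \<open>All edges at a vertex before position \<open>q\<close> have been found.\<close>

definition handled :: "int set set \<Rightarrow> int list \<Rightarrow> nat \<Rightarrow> bool" where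
  "handled H xs q \<longleftrightarrow> q \<le> length xs \<and> (\<forall>i<q. \<forall>g\<in>H. xs ! i \<in> g \<longrightarrow> g \<subseteq> set xs)"

lemma handled_append: "handled H xs q \<Longrightarrow> handled H (xs @ ys) q"
  unfolding handled_def by (auto simp: nth_append subset_iff)

lemma handled_all:
  assumes "handled H xs (length xs)" "g \<in> H" "g \<inter> set xs \<noteq> {}"
  shows "g \<subseteq> set xs"
  using assms unfolding handled_def by (metis disjoint_iff in_set_conv_nth)

lemma handled_Suc:
  assumes "handled H xs q" "q < length xs" "\<And>g. g \<in> H \<Longrightarrow> xs ! q \<in> g \<Longrightarrow> g \<subseteq> set xs"
  shows "handled H xs (Suc q)"
  using assms unfolding handled_def by (auto simp: less_Suc_eq)

end

section \<open>Explorations of a critical pair\<close>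

lemma new_card_le:
  assumes "finite g" "v \<in> g" "v \<in> X" "g \<inter> X \<noteq> {v}"
  shows "card (g - X) + 2 \<le> card g"
proof -
  obtain w where w: "w \<in> g" "w \<in> X" "w \<noteq> v" using assms(2-4) by blast
  have "card (g - X) \<le> card (g - {v, w})" using assms w by (intro card_mono) auto
  also have "\<dots> = card g - 2" using assms w by (subst card_Diff_subset) auto
  finally have *: "card (g - X) \<le> card g - 2" .
  have "card {v, w} \<le> card g" using assms w by (intro card_mono) auto
  then show ?thesis using * w by simp
qed

text \<open>The situation to be refuted: a critical pair of families of solution sets inside \<open>S\<close>, although no
exploration of \<open>S\<close> leads to an unlikely state.\<close>

locale critical_pair = two_equations +
  fixes S :: "int set" and P Q :: "int set set" and T :: nat
  assumes fin_S: "finite S"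
    and crit: "critical P Q"
    and P_sol: "P \<subseteq> solution_sets a \<alpha>" and Q_sol: "Q \<subseteq> solution_sets b \<beta>"
    and P_S: "g \<in> P \<Longrightarrow> g \<subseteq> S" and Q_S: "g \<in> Q \<Longrightarrow> g \<subseteq> S"
    and T_large: "b + 1 < T"
    and likely: "\<not> unlikely S T"
begin

definition H :: "int set set" where
  "H = P \<union> Q"

lemma H_props: "g \<in> H \<Longrightarrow> g \<in> edges \<and> g \<subseteq> S \<and> finite g \<and> 3 \<le> card g \<and> card g \<le> b"
proof -
  assume g: "g \<in> H"
  have "g \<in> edges" using g P_sol Q_sol unfolding H_def edges_def by auto
  moreover have "g \<subseteq> S" using g P_S[of g] Q_S[of g] unfolding H_def by auto
  ultimately show ?thesis using edges_card[of g] by simp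
qed

lemma P_card: "g \<in> P \<Longrightarrow> card g = a" and Q_card: "g \<in> Q \<Longrightarrow> card g = b"
  using P_sol Q_sol solution_sets_card by auto

lemma P_nonempty: "P \<noteq> {}"
proof
  assume P: "P = {}"
  have "(\<exists>g\<in>P. g \<subseteq> UNIV) \<or> (\<exists>h\<in>Q. h \<inter> UNIV = {})"
    using crit by (simp only: critical_def uncolourable_def)
  then have "{} \<in> Q" using P by auto
  then show False using Q_card[of "{}"] a3 ab by simp
qed

lemma crossing_Q: "h \<in> Q \<Longrightarrow> v \<in> h \<Longrightarrow> \<exists>e\<in>P. h \<inter> e = {v}"
  by (rule critical_crossing[OF critical_swap[OF crit]])

lemma crossing_H: "g \<in> H \<Longrightarrow> v \<in> g \<Longrightarrow> \<exists>h\<in>H. g \<inter> h = {v}"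
  unfolding H_def by (rule critical_crossing_union[OF crit])

lemma potential_nonneg:
  "(xs, q, e, f) \<in> layer S t \<Longrightarrow> t \<le> 2 * T \<Longrightarrow> f \<le> max_free \<Longrightarrow> 0 \<le> potential (xs, q, e, f)"
  using unlikelyI(1)[of xs q e f S t T] likely by linarith

lemma potential_late:
  "(xs, q, e, f) \<in> layer S t \<Longrightarrow> T \<le> t \<Longrightarrow> t \<le> 2 * T \<Longrightarrow> f \<le> max_free \<Longrightarrow> int a < potential (xs, q, e, f)"
  using unlikelyI(2)[of xs q e f S t T] likely by linarith

lemma layer_handled_0: "handled H xs 0"
  by (simp add: handled_def)

lemma free_step_H:
  assumes "(xs, q, e, f) \<in> layer S t" "g \<in> H" "\<not> g \<subseteq> set xs"
  shows "\<exists>ys. (xs @ ys, q, Suc e, Suc f) \<in> layer S (Suc t) \<and> set (xs @ ys) = set xs \<union> g \<and>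
           potential (xs @ ys, q, Suc e, Suc f)
             = potential (xs, q, e, f) + int b * int (card (g - set xs)) - int a * (int b - 1)"
  using free_step[OF assms(1) _ _ assms(3) refl] H_props[OF assms(2)] by blast

lemma forced_step_H:
  assumes "(xs, q, e, f) \<in> layer S t" "g \<in> H" "g \<inter> set xs = {xs ! i}"
    and "i < length xs" "i = q \<or> length xs \<le> i + window"
  shows "\<exists>ys. (xs @ ys, q, Suc e, f) \<in> layer S (Suc t) \<and> set (xs @ ys) = set xs \<union> g \<and> length ys \<le> card g \<and>
           potential (xs @ ys, q, Suc e, f)
             = potential (xs, q, e, f) + int b * int (card g - 1) - int a * (int b - 1)"
proof -
  have "length (sorted_list_of_set (g - set xs)) \<le> card g"
    using H_props[OF assms(2)] by (simp add: card_mono)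
  then show ?thesis
    using forced_step[OF assms(1) _ _ assms(3) refl assms(4,5)] H_props[OF assms(2)] by blast
qed

text \<open>This is how an exploration that has come to an end is refuted.  Let \<open>h\<close> be the edge that was added
last, to the vertex set \<open>X\<close>.  An edge crossing \<open>h\<close> exactly in one of the new vertices \<open>z\<close> has been found
as well, so it has no other new vertex.  Added to \<open>X\<close> in place of \<open>h\<close>, it
gains an edge at the price of a single vertex.\<close>

lemma crossing_with_one_new_vertex:
  assumes closed: "\<And>g. g \<in> H \<Longrightarrow> g \<inter> (X \<union> h) \<noteq> {} \<Longrightarrow> g \<subseteq> X \<union> h"
    and h: "h \<in> H" "z \<in> h" "z \<notin> X"
  shows "\<exists>h'\<in>H. h' - X = {z}"
proof -
  obtain h' where h': "h' \<in> H" "h \<inter> h' = {z}" using crossing_H[OF h(1,2)] by (rule bexE)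
  have "z \<in> h'" using h'(2) by auto
  then have "h' \<subseteq> X \<union> h" using closed[OF h'(1)] h(2) by auto
  then have "h' - X = {z}" using h'(2) h(3) \<open>z \<in> h'\<close> by auto
  then show ?thesis using h'(1) by (rule_tac bexI)
qed

end

section \<open>Equations with equally many variables\<close>

text \<open>If \<open>a = b\<close>, the two kinds of edges play the same role.  The potential is then \<open>a\<close> times
\<open>v - (a - 1) * e\<close>: it starts at \<open>a\<close>, is unchanged if an edge is attached by a single vertex, and
drops by \<open>a\<close> for every further common vertex.\<close>

locale critical_pair_same_size = critical_pair +
  assumes same: "b = a"
begin

lemma H_card: "g \<in> H \<Longrightarrow> card g = a"
  using P_card Q_card same unfolding H_def by blast

lemma potential_change: "int b * int m - int a * (int b - 1) = int a * (int m + 1 - int a)"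
  by (simp add: same algebra_simps)

lemma potential_change_le:
  assumes "m + j \<le> a"
  shows "int b * int m - int a * (int b - 1) \<le> int a * (1 - int j)"
  unfolding potential_change using assms by (intro mult_left_mono) auto

lemma potential_change_forced: "int b * int (a - 1) - int a * (int b - 1) = 0"
  using a3 by (simp add: same of_nat_diff)

text \<open>Once the potential is zero, every edge must be attached by a single vertex.  If the
exploration could be continued at all, it would end with a last edge, and an edge
crossing it with one new vertex would make the potential negative.  So it cannot be continued.\<close>

lemma saturated:
  assumes st: "(xs, q, e, f) \<in> layer S t" "t \<le> 2 * T" "f \<le> a + 5" "handled H xs q"
    and pot: "potential (xs, q, e, f) \<le> 0" and g: "g \<in> H" "g \<inter> set xs \<noteq> {}"
  shows "g \<subseteq> set xs"
proof -
  have mf: "a + 6 \<le> max_free" using a3 same unfolding max_free_def by linarith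
  have tT: "t < T"
  proof (rule ccontr)
    assume "\<not> t < T"
    then have "int a < potential (xs, q, e, f)" using potential_late[OF st(1)] st mf by simp
    then show False using pot by simp
  qed
  define link where "link t' ys \<longleftrightarrow> (\<exists>t1 ys1 r1 e1 f1 h. (ys1, r1, e1, f1) \<in> layer S t1 \<and> t1 \<le> t' \<and>
      potential (ys1, r1, e1, f1) \<le> 0 \<and> f1 \<le> f \<and> h \<in> H \<and> \<not> h \<subseteq> set ys1 \<and> set ys = set ys1 \<union> h)"
    for t' :: nat and ys
  have link_mono: "link t' ys \<Longrightarrow> link (Suc t') ys" for t' ys
    unfolding link_def using le_SucI by blast
  define Inv where "Inv t' = (\<lambda>(ys, r, e', f'). (ys, r, e', f') \<in> layer S t' \<and> handled H ys r \<and>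
      potential (ys, r, e', f') \<le> 0 \<and> f' \<le> f \<and> set xs \<subseteq> set ys \<and> (set ys = set xs \<or> link t' ys))"
    for t' :: nat
  have "\<exists>t' s. t' < T \<and> Inv t' s \<and> (\<lambda>(ys, r, e', f'). r = length ys) s"
  proof (rule run_until_final[where d = 1])
    show "Inv t (xs, q, e, f)" using st pot by (simp add: Inv_def)
    show "t \<le> T + 1" using tT by simp
  next
    fix t' s assume s: "Inv t' s" "T \<le> t'" "t' \<le> T + 1"
    obtain ys r e' f' where s': "s = (ys, r, e', f')" by (cases s) auto
    have "int a < potential (ys, r, e', f')"
      using s potential_late[of ys r e' f' t'] st(3) mf T_large unfolding s' Inv_def by auto
    then show False using s(1) unfolding s' Inv_def by simp
  next
    fix t' s assume s: "Inv t' s" "t' < T" "\<not> (\<lambda>(ys, r, e', f'). r = length ys) s"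
    obtain ys r e' f' where s': "s = (ys, r, e', f')" by (cases s) auto
    have I: "(ys, r, e', f') \<in> layer S t'" "handled H ys r" "potential (ys, r, e', f') \<le> 0" "f' \<le> f"
      "set xs \<subseteq> set ys" "set ys = set xs \<or> link t' ys" using s(1) unfolding s' Inv_def by auto
    have r: "r < length ys" using I(2) s(3) unfolding s' handled_def by auto
    show "\<exists>t'' s''. Inv t'' s'' \<and> t' < t'' \<and> t'' \<le> t' + 1"
    proof (cases "\<exists>h\<in>H. ys ! r \<in> h \<and> \<not> h \<subseteq> set ys")
      case True
      then obtain h where h: "h \<in> H" "ys ! r \<in> h" "\<not> h \<subseteq> set ys" by blast
      have yr: "ys ! r \<in> set ys" using r by simp
      have one: "h \<inter> set ys = {ys ! r}"
      proof (rule ccontr)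
        assume "h \<inter> set ys \<noteq> {ys ! r}"
        then have c: "card (h - set ys) + 2 \<le> a"
          using new_card_le[of h "ys ! r" "set ys"] h yr H_props[OF h(1)] H_card[OF h(1)] by auto
        obtain zs where zs: "(ys @ zs, r, Suc e', Suc f') \<in> layer S (Suc t')"
          "potential (ys @ zs, r, Suc e', Suc f')
             = potential (ys, r, e', f') + int b * int (card (h - set ys)) - int a * (int b - 1)"
          using free_step_H[OF I(1) h(1,3)] by blast
        have "potential (ys @ zs, r, Suc e', Suc f') < 0"
          using zs(2) I(3) potential_change_le[OF c] a3 by simp
        moreover have "0 \<le> potential (ys @ zs, r, Suc e', Suc f')"
          using potential_nonneg[OF zs(1)] s(2) I(4) st(3) mf by simp
        ultimately show False by simp
      qed
      obtain zs where zs: "(ys @ zs, r, Suc e', f') \<in> layer S (Suc t')" "set (ys @ zs) = set ys \<union> h"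
        "potential (ys @ zs, r, Suc e', f')
           = potential (ys, r, e', f') + int b * int (card h - 1) - int a * (int b - 1)"
        using forced_step_H[OF I(1) h(1) one r] by blast
      have "potential (ys @ zs, r, Suc e', f') \<le> 0"
        using zs(3) I(3) potential_change_forced H_card[OF h(1)] by simp
      moreover have "link (Suc t') (ys @ zs)"
        unfolding link_def using I(1,3,4) h(1,3) zs(2) le_SucI[OF order_refl, of t'] by blast
      moreover have "handled H (ys @ zs) r" using handled_append[OF I(2)] .
      moreover have "set xs \<subseteq> set (ys @ zs)" using I(5) by auto
      ultimately have "Inv (Suc t') (ys @ zs, r, Suc e', f')"
        unfolding Inv_def using zs(1) I(4) by blast
      then show ?thesis by (rule_tac exI, rule_tac exI) auto
    next
      case False
      have "handled H ys (Suc r)" using handled_Suc[OF I(2) r] False by blast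
      moreover have "(ys, Suc r, e', f') \<in> layer S (Suc t')" by (rule advance_step[OF I(1) r])
      moreover have "potential (ys, Suc r, e', f') \<le> 0" using I(3) by simp
      moreover have "set ys = set xs \<or> link (Suc t') ys" using I(6) link_mono by blast
      ultimately have "Inv (Suc t') (ys, Suc r, e', f')"
        unfolding Inv_def using I(4,5) by blast
      then show ?thesis by (rule_tac exI, rule_tac exI) auto
    qed
  qed
  then obtain t' ys r e' f' where fin: "t' < T" "Inv t' (ys, r, e', f')" "r = length ys" by auto
  have I: "handled H ys (length ys)" "set xs \<subseteq> set ys" "set ys = set xs \<or> link t' ys"
    using fin(2,3) unfolding Inv_def by auto
  have closed: "\<And>h. h \<in> H \<Longrightarrow> h \<inter> set ys \<noteq> {} \<Longrightarrow> h \<subseteq> set ys" using handled_all[OF I(1)] .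
  have "\<not> link t' ys"
  proof
    assume "link t' ys"
    then obtain t1 ys1 r1 e1 f1 h where l: "(ys1, r1, e1, f1) \<in> layer S t1" "t1 \<le> t'"
      "potential (ys1, r1, e1, f1) \<le> 0" "f1 \<le> f" "h \<in> H" "\<not> h \<subseteq> set ys1" "set ys = set ys1 \<union> h"
      unfolding link_def by blast
    obtain z where z: "z \<in> h" "z \<notin> set ys1" using l(6) by blast
    obtain h' where h': "h' \<in> H" "h' - set ys1 = {z}"
      using crossing_with_one_new_vertex[OF _ l(5) z] closed unfolding l(7) by blast
    then have "\<not> h' \<subseteq> set ys1" by blast
    from free_step_H[OF l(1) h'(1) this] obtain zs where zs: "(ys1 @ zs, r1, Suc e1, Suc f1) \<in> layer S (Suc t1)"
      "potential (ys1 @ zs, r1, Suc e1, Suc f1)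
         = potential (ys1, r1, e1, f1) + int b * int (card (h' - set ys1)) - int a * (int b - 1)"
      by blast
    have "card (h' - set ys1) + 2 \<le> a" using h'(2) a3 by simp
    then have "potential (ys1 @ zs, r1, Suc e1, Suc f1) < 0"
      using zs(2) l(3) potential_change_le[of "card (h' - set ys1)" 2] a3 by simp
    moreover have "0 \<le> potential (ys1 @ zs, r1, Suc e1, Suc f1)"
      using potential_nonneg[OF zs(1)] l(2,4) fin(1) st(3) mf by simp
    ultimately show False by simp
  qed
  then have "set ys = set xs" using I(3) by simp
  then show ?thesis using closed[OF g(1)] g(2) by simp
qed

declare potential.simps [simp del]

text \<open>The invariant of explorations in which every edge after the first one is attached by a single vertex,
so that the only free move is the one that finds the first edge.\<close>

definition tree_state :: "nat \<Rightarrow> state \<Rightarrow> bool" where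
  "tree_state t = (\<lambda>(xs, q, e, f). (xs, q, e, f) \<in> layer S t \<and> handled H xs q \<and>
     potential (xs, q, e, f) \<le> int a \<and> f \<le> 1)"

lemma max_free_ge: "a + 6 \<le> max_free"
  using a3 same unfolding max_free_def by linarith

text \<open>Adding \<open>h\<close> lowers the potential of a tree to zero or less.  Then the exploration would have to be
complete, although the edge \<open>g\<close> still has a vertex outside.\<close>

lemma no_single_new_vertex:
  assumes s: "tree_state t (ys, r, e, f)" "t < T"
    and h: "h \<in> H" "h - set ys = {z}" and g: "g \<in> H" "z \<in> g" "2 \<le> card (g - set ys)"
  shows False
proof -
  have I: "(ys, r, e, f) \<in> layer S t" "handled H ys r" "potential (ys, r, e, f) \<le> int a" "f \<le> 1"
    using s(1) unfolding tree_state_def by auto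
  have "\<not> h \<subseteq> set ys" using h(2) by auto
  from free_step_H[OF I(1) h(1) this] obtain zs where
    zs: "(ys @ zs, r, Suc e, Suc f) \<in> layer S (Suc t)" "set (ys @ zs) = set ys \<union> h"
      "potential (ys @ zs, r, Suc e, Suc f)
         = potential (ys, r, e, f) + int b * int (card (h - set ys)) - int a * (int b - 1)"
    by blast
  have "card (h - set ys) + 2 \<le> a" using h(2) a3 by simp
  then have pot: "potential (ys @ zs, r, Suc e, Suc f) \<le> 0"
    using zs(3) I(3) potential_change_le[of "card (h - set ys)" 2] by simp
  have "z \<in> set (ys @ zs)" using zs(2) h(2) by auto
  then have meets: "g \<inter> set (ys @ zs) \<noteq> {}" using g(2) by auto
  have "g \<subseteq> set (ys @ zs)"
    by (rule saturated[OF zs(1) _ _ handled_append[OF I(2)] pot g(1) meets]) (use s(2) I(4) a3 in auto)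
  then have "g - set ys \<subseteq> {z}" using zs(2) h(2) by auto
  then have "card (g - set ys) \<le> card {z}" by (intro card_mono) auto
  then show False using g(3) by simp
qed

definition last_edge :: "nat \<Rightarrow> int list \<Rightarrow> bool" where
  "last_edge t xs \<longleftrightarrow> (\<exists>t1 ys r e f h. t1 \<le> t \<and> tree_state t1 (ys, r, e, f) \<and> h \<in> H \<and>
     2 \<le> card (h - set ys) \<and> set xs = set ys \<union> h)"

lemma first_edge:
  assumes "g \<in> H"
  shows "\<exists>xs. (xs, 0, 1, 1) \<in> layer S 1 \<and> set xs = g \<and> potential (xs, 0, 1, 1) \<le> int a"
proof -
  have start: "([], 0, 0, 0) \<in> layer S 0" by simp
  have "\<not> g \<subseteq> set []" using H_props[OF assms] by auto
  from free_step_H[OF start assms this] obtain xs where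
    xs: "(xs, 0, 1, 1) \<in> layer S 1" "set xs = g"
      "potential (xs, 0, 1, 1) = int b * int (card g) - int a * (int b - 1)" by (auto simp: potential.simps)
  have "potential (xs, 0, 1, 1) \<le> int a" using xs(3) potential_change_le[of a 0] H_card[OF assms] by simp
  then show ?thesis using xs by blast
qed

text \<open>A tree is grown until it is complete or an edge closes a cycle.\<close>

lemma explore:
  "\<exists>t xs q e f. t < T \<and> tree_state t (xs, q, e, f) \<and> last_edge t xs \<and>
     (q = length xs \<or> q < length xs \<and> (\<exists>g\<in>H. xs ! q \<in> g \<and> \<not> g \<subseteq> set xs \<and> g \<inter> set xs \<noteq> {xs ! q}))"
proof -
  define final where "final = (\<lambda>(xs :: int list, q, e :: nat, f :: nat).
      q = length xs \<or> q < length xs \<and> (\<exists>g\<in>H. xs ! q \<in> g \<and> \<not> g \<subseteq> set xs \<and> g \<inter> set xs \<noteq> {xs ! q}))"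
  define Inv where "Inv t = (\<lambda>(xs, q, e, f). tree_state t (xs, q, e, f) \<and> last_edge t xs)" for t
  have last_mono: "last_edge t xs \<Longrightarrow> last_edge (Suc t) xs" for t xs
    unfolding last_edge_def using le_SucI by blast
  obtain g0 where g0: "g0 \<in> H" using P_nonempty unfolding H_def by auto
  have tree0: "tree_state 0 ([], 0, 0, 0)" by (simp add: tree_state_def layer_handled_0 potential.simps)
  obtain xs0 where xs0: "(xs0, 0, 1, 1) \<in> layer S 1" "set xs0 = g0" "potential (xs0, 0, 1, 1) \<le> int a"
    using first_edge[OF g0] by blast
  then have tree1: "tree_state 1 (xs0, 0, 1, 1)" by (simp add: tree_state_def layer_handled_0)
  have "2 \<le> card (g0 - set [])" using H_card[OF g0] a3 by simp
  then have last1: "last_edge 1 xs0"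
    unfolding last_edge_def
    by (intro exI[of _ 0] exI[of _ "[]"] exI[of _ g0] conjI) (use tree0 g0 xs0(2) in auto)
  have "\<exists>t s. t < T \<and> Inv t s \<and> final s"
  proof (rule run_until_final[where d = 1])
    show "Inv 1 (xs0, 0, 1, 1)" using tree1 last1 by (simp add: Inv_def)
    show "1 \<le> T + 1" by simp
  next
    fix t s assume s: "Inv t s" "T \<le> t" "t \<le> T + 1"
    obtain xs q e f where s': "s = (xs, q, e, f)" by (cases s) auto
    have "int a < potential (xs, q, e, f)"
      using s potential_late[of xs q e f t] max_free_ge T_large unfolding s' Inv_def tree_state_def by auto
    then show False using s(1) unfolding s' Inv_def tree_state_def by simp
  next
    fix t s assume s: "Inv t s" "t < T" "\<not> final s"
    obtain xs q e f where s': "s = (xs, q, e, f)" by (cases s) auto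
    have I: "(xs, q, e, f) \<in> layer S t" "handled H xs q" "potential (xs, q, e, f) \<le> int a" "f \<le> 1"
      "last_edge t xs" "tree_state t (xs, q, e, f)" using s(1) unfolding s' Inv_def tree_state_def by auto
    have q: "q < length xs" using I(2) s(3) unfolding s' final_def handled_def by auto
    show "\<exists>t' s'. Inv t' s' \<and> t < t' \<and> t' \<le> t + 1"
    proof (cases "\<exists>h\<in>H. xs ! q \<in> h \<and> \<not> h \<subseteq> set xs")
      case True
      then obtain h where h: "h \<in> H" "xs ! q \<in> h" "\<not> h \<subseteq> set xs" by blast
      then have one: "h \<inter> set xs = {xs ! q}" using s(3) q unfolding s' final_def by auto
      obtain zs where zs: "(xs @ zs, q, Suc e, f) \<in> layer S (Suc t)" "set (xs @ zs) = set xs \<union> h"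
        "potential (xs @ zs, q, Suc e, f)
           = potential (xs, q, e, f) + int b * int (card h - 1) - int a * (int b - 1)"
        using forced_step_H[OF I(1) h(1) one q] by blast
      have "potential (xs @ zs, q, Suc e, f) \<le> int a"
        using zs(3) I(3) potential_change_forced H_card[OF h(1)] by simp
      then have "tree_state (Suc t) (xs @ zs, q, Suc e, f)"
        using zs(1) handled_append[OF I(2)] I(4) unfolding tree_state_def by blast
      moreover have "2 \<le> card (h - set xs)"
      proof -
        have "card (h - set xs) = card (h - {xs ! q})" using one by (intro arg_cong[of _ _ card]) blast
        then show ?thesis using H_card[OF h(1)] H_props[OF h(1)] h(2) a3 by simp
      qed
      then have "last_edge (Suc t) (xs @ zs)"
        unfolding last_edge_def using I(6) h(1) zs(2) le_SucI[OF order_refl, of t] by blast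
      ultimately have "Inv (Suc t) (xs @ zs, q, Suc e, f)" unfolding Inv_def by blast
      then show ?thesis by (rule_tac exI, rule_tac exI) auto
    next
      case False
      have "handled H xs (Suc q)" using handled_Suc[OF I(2) q] False by blast
      moreover have "(xs, Suc q, e, f) \<in> layer S (Suc t)" by (rule advance_step[OF I(1) q])
      moreover have "potential (xs, Suc q, e, f) \<le> int a" using I(3) by (simp add: potential.simps)
      ultimately have "Inv (Suc t) (xs, Suc q, e, f)"
        unfolding Inv_def tree_state_def using I(4) last_mono[OF I(5)] by blast
      then show ?thesis by (rule_tac exI, rule_tac exI) auto
    qed
  qed
  then obtain t s where ts: "t < T" "Inv t s" "final s" by blast
  obtain xs q e f where s': "s = (xs, q, e, f)" by (cases s) auto
  show ?thesis
    by (rule exI[of _ t], rule exI[of _ xs], rule exI[of _ q], rule exI[of _ e], rule exI[of _ f])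
      (use ts in \<open>simp add: s' Inv_def final_def\<close>)
qed

text \<open>Two edges with two common vertices already have potential zero, so their union is a component.
But an edge crossing \<open>g\<close> in one vertex has only \<open>card (h - g) < a - 1\<close> candidates for its other
vertices.\<close>

lemma edges_share_at_most_one_vertex:
  assumes g: "g \<in> H" "h \<in> H" "g \<noteq> h"
  shows "card (g \<inter> h) \<le> 1"
proof (rule ccontr)
  assume c: "\<not> card (g \<inter> h) \<le> 1"
  have fin: "finite g" "finite h" using H_props g by auto
  have "g \<inter> h \<noteq> {}" using c by auto
  then obtain v where v: "v \<in> g \<inter> h" by blast
  have "h \<inter> g \<noteq> {v}" using c by (auto simp: Int_commute)
  then have c2: "card (h - g) + 2 \<le> a" using new_card_le[of h v g] v fin H_card[OF g(2)] by auto
  obtain xs where xs: "(xs, 0, 1, 1) \<in> layer S 1" "set xs = g" "potential (xs, 0, 1, 1) \<le> int a"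
    using first_edge[OF g(1)] by blast
  have "\<not> h \<subseteq> set xs"
  proof
    assume "h \<subseteq> set xs"
    then have "h = g" using xs(2) fin H_card[OF g(1)] H_card[OF g(2)] by (intro card_subset_eq) auto
    then show False using g(3) by simp
  qed
  from free_step_H[OF xs(1) g(2) this] obtain zs where
    zs: "(xs @ zs, 0, Suc 1, Suc 1) \<in> layer S (Suc 1)" "set (xs @ zs) = set xs \<union> h"
      "potential (xs @ zs, 0, Suc 1, Suc 1)
         = potential (xs, 0, 1, 1) + int b * int (card (h - set xs)) - int a * (int b - 1)"
    by blast
  have "potential (xs @ zs, 0, Suc 1, Suc 1) \<le> 0"
    using zs(3) xs(2,3) potential_change_le[OF c2] by simp
  note sat = saturated[OF zs(1) _ _ layer_handled_0 this]
  obtain k where k: "k \<in> H" "g \<inter> k = {v}" using crossing_H[of g v] g v by auto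
  have "k \<subseteq> set (xs @ zs)"
    by (rule sat) (use k T_large v xs(2) in auto)
  then have "k \<subseteq> insert v (h - g)" using zs(2) xs(2) k(2) by auto
  then have "card k \<le> card (insert v (h - g))" using fin by (intro card_mono) auto
  also have "\<dots> \<le> Suc (card (h - g))" by (rule card_insert_le_m1) auto
  finally show False using H_card[OF k(1)] c2 by simp
qed

text \<open>Three triples that pairwise meet in three different vertices have potential zero and form a component
on six vertices.  The only further triple that can occur in it completes the configuration of Pasch,
that is, four lines of which any two meet.  It satisfies the crossing condition and may appear with
positive probability, so it cannot be refuted by counting; but it can be coloured, by
taking for \<open>C\<close> two vertices that are not on a common line.\<close>

lemma triangle_contradiction:
  assumes a3': "a = 3" and H: "g \<in> H" "h1 \<in> H" "h2 \<in> H"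
    and z: "g \<inter> h1 = {z1}" "g \<inter> h2 = {z2}" "z1 \<noteq> z2" and w: "w \<in> h1" "w \<in> h2" "w \<notin> g"
  shows False
proof -
  have fin: "finite g" "finite h1" "finite h2" using H_props H by auto
  have card: "card g = 3" "card h1 = 3" "card h2 = 3" using H_card H a3' by auto
  obtain xs where xs: "(xs, 0, 1, 1) \<in> layer S 1" "set xs = g" "potential (xs, 0, 1, 1) \<le> int a"
    using first_edge[OF H(1)] by blast
  have "\<not> h1 \<subseteq> set xs" using w xs(2) by auto
  from free_step_H[OF xs(1) H(2) this] obtain ys where
    ys: "(xs @ ys, 0, Suc 1, Suc 1) \<in> layer S (Suc 1)" "set (xs @ ys) = set xs \<union> h1"
      "potential (xs @ ys, 0, Suc 1, Suc 1)
         = potential (xs, 0, 1, 1) + int b * int (card (h1 - set xs)) - int a * (int b - 1)"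
    by blast
  have zin: "z1 \<in> h1" "z1 \<in> g" "z2 \<in> h2" "z2 \<in> g" using z(1,2) by blast+
  have c1: "card (h1 - g) = 2"
  proof -
    have "h1 - g = h1 - {z1}" using z(1) by auto
    then show ?thesis using card(2) zin(1) by (simp add: card_Diff_singleton)
  qed
  have p1: "potential (xs @ ys, 0, Suc 1, Suc 1) \<le> int a"
    using ys(3) xs(2,3) c1 potential_change_le[of 2 1] a3' by simp
  have h2ys: "h2 - set (xs @ ys) = h2 - (g \<union> h1)" using ys(2) xs(2) by simp
  have "w \<noteq> z2" using w z by auto
  then have "h2 \<inter> (g \<union> h1) \<noteq> {z2}" using w by auto
  moreover have "z2 \<in> h2" "z2 \<in> g \<union> h1" using z(2) by auto
  ultimately have c2: "card (h2 - (g \<union> h1)) + 2 \<le> a"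
    using new_card_le[of h2 z2 "g \<union> h1"] fin card(3) a3' by auto
  have "\<not> h2 \<subseteq> set (xs @ ys)"
  proof
    assume "h2 \<subseteq> set (xs @ ys)"
    then have "h2 \<subseteq> g \<union> h1" using ys(2) xs(2) by simp
    then have "h2 \<subseteq> insert z2 (h1 \<inter> h2)" using z(2) by auto
    then have "card h2 \<le> card (insert z2 (h1 \<inter> h2))" using fin by (intro card_mono) auto
    also have "\<dots> \<le> Suc (card (h1 \<inter> h2))" by (rule card_insert_le_m1) auto
    also have "\<dots> \<le> 2"
    proof -
      have "h1 \<noteq> h2" using z by auto
      then show ?thesis using edges_share_at_most_one_vertex[OF H(2,3)] by simp
    qed
    finally show False using card(3) by simp
  qed
  from free_step_H[OF ys(1) H(3) this] obtain zs where
    zs: "((xs @ ys) @ zs, 0, Suc (Suc 1), Suc (Suc 1)) \<in> layer S (Suc (Suc 1))" "set ((xs @ ys) @ zs) = set (xs @ ys) \<union> h2"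
      "potential ((xs @ ys) @ zs, 0, Suc (Suc 1), Suc (Suc 1))
         = potential (xs @ ys, 0, Suc 1, Suc 1) + int b * int (card (h2 - set (xs @ ys))) - int a * (int b - 1)"
    by blast
  have "potential ((xs @ ys) @ zs, 0, Suc (Suc 1), Suc (Suc 1)) \<le> 0"
    using zs(3) p1 potential_change_le[OF c2] unfolding h2ys by simp
  note sat = saturated[OF zs(1) _ _ layer_handled_0 this]
  define X where "X = g \<union> h1 \<union> h2"
  have X: "set ((xs @ ys) @ zs) = X" unfolding zs(2) ys(2) xs(2) X_def by simp
  have closed: "k \<subseteq> X" if "k \<in> H" "k \<inter> X \<noteq> {}" for k
    using sat[OF _ _ that(1)] that(2) T_large a3' unfolding X by simp
  have "card (g - {z1, z2}) = 1"
    using card(1) zin z(3) by (subst card_Diff_subset) simp_all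
  then obtain v where v: "g - {z1, z2} = {v}" by (rule card_1_singletonE)
  have C: "{v, w} \<subseteq> X" using v w by (auto simp: X_def)
  \<comment> \<open>An edge avoiding \<open>v\<close> and \<open>w\<close> would be covered by \<open>h1\<close> and \<open>h2\<close> and have two vertices in one of them.\<close>
  have "k \<inter> {v, w} \<noteq> {} \<and> \<not> k \<subseteq> {v, w}" if k: "k \<in> H" "k \<subseteq> X" for k
  proof
    have ck: "card k = 3" using H_card[OF k(1)] a3' by simp
    show "\<not> k \<subseteq> {v, w}"
    proof
      assume "k \<subseteq> {v, w}"
      then have "card k \<le> card {v, w}" by (intro card_mono) auto
      also have "\<dots> \<le> 2" by (simp add: card_insert_if)
      finally show False using ck by simp
    qed
    show "k \<inter> {v, w} \<noteq> {}"
    proof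
      assume dis: "k \<inter> {v, w} = {}"
      have "g \<subseteq> {v} \<union> h1 \<union> h2" using v z by auto
      then have "k \<subseteq> (k \<inter> h1) \<union> (k \<inter> h2)" using k(2) dis unfolding X_def by auto
      then have "card k \<le> card ((k \<inter> h1) \<union> (k \<inter> h2))" using fin by (intro card_mono) auto
      also have "\<dots> \<le> card (k \<inter> h1) + card (k \<inter> h2)" by (rule card_Un_le)
      also have "\<dots> \<le> 1 + 1"
        using edges_share_at_most_one_vertex[OF k(1) H(2)] edges_share_at_most_one_vertex[OF k(1) H(3)] w dis by (intro add_mono) auto
      finally show False using ck by simp
    qed
  qed
  then have "\<not> (\<exists>k\<in>P \<union> Q. k \<subseteq> X)"
    using critical_component_not_bicolourable[OF crit _ C] closed unfolding H_def by blast
  then show False using H(1) unfolding H_def X_def by blast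
qed

text \<open>A complete tree is refuted by an edge that crosses its last edge.  If an edge \<open>g\<close> closes a cycle,
the potential is zero and the exploration is complete.  A crossing edge shows that \<open>g\<close> has just
one new vertex \<open>w\<close>, which forces \<open>a = 3\<close>.  Edges that cross the last edge \<open>h\<close> of the tree in its
two new vertices must both contain \<open>w\<close>, and a triangle arises.\<close>

theorem contradiction_same_size: False
proof -
  obtain t xs q e f where s: "t < T" "tree_state t (xs, q, e, f)" "last_edge t xs" and
    fin: "q = length xs \<or> q < length xs \<and> (\<exists>g\<in>H. xs ! q \<in> g \<and> \<not> g \<subseteq> set xs \<and> g \<inter> set xs \<noteq> {xs ! q})"
    using explore by blast
  have I: "(xs, q, e, f) \<in> layer S t" "handled H xs q" "potential (xs, q, e, f) \<le> int a" "f \<le> 1"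
    using s(2) unfolding tree_state_def by auto
  obtain t1 ys r e1 f1 h where l: "t1 \<le> t" "tree_state t1 (ys, r, e1, f1)" "h \<in> H"
     "2 \<le> card (h - set ys)" "set xs = set ys \<union> h"
    using s(3) unfolding last_edge_def by blast
  have t1: "t1 < T" using l(1) s(1) by simp
  have one: False if "k \<in> H" "k - set ys = {z}" "z \<in> h" for k z
    using no_single_new_vertex[OF l(2) t1 that(1,2) l(3) that(3) l(4)] .
  from fin show False
  proof
    assume "q = length xs"
    then have closed: "\<And>g. g \<in> H \<Longrightarrow> g \<inter> (set ys \<union> h) \<noteq> {} \<Longrightarrow> g \<subseteq> set ys \<union> h"
      using handled_all[of H xs] I(2) l(5) by auto
    have "h - set ys \<noteq> {}"
    proof
      assume "h - set ys = {}"
      then have "card (h - set ys) = 0" by (simp only: card.empty)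
      then show False using l(4) by simp
    qed
    then obtain z where z: "z \<in> h" "z \<notin> set ys" by blast
    obtain k where "k \<in> H" "k - set ys = {z}"
      using crossing_with_one_new_vertex[OF closed l(3) z] by blast
    then show False using one z(1) by blast
  next
    assume "q < length xs \<and> (\<exists>g\<in>H. xs ! q \<in> g \<and> \<not> g \<subseteq> set xs \<and> g \<inter> set xs \<noteq> {xs ! q})"
    then obtain g where q: "q < length xs" and g: "g \<in> H" "xs ! q \<in> g" "\<not> g \<subseteq> set xs" "g \<inter> set xs \<noteq> {xs ! q}"
      by blast
    have c: "card (g - set xs) + 2 \<le> a"
      using new_card_le[of g "xs ! q" "set xs"] g q H_props[OF g(1)] H_card[OF g(1)] by auto
    obtain zs where zs: "(xs @ zs, q, Suc e, Suc f) \<in> layer S (Suc t)" "set (xs @ zs) = set xs \<union> g"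
      "potential (xs @ zs, q, Suc e, Suc f)
         = potential (xs, q, e, f) + int b * int (card (g - set xs)) - int a * (int b - 1)"
      using free_step_H[OF I(1) g(1,3)] by blast
    have "potential (xs @ zs, q, Suc e, Suc f) \<le> 0"
      using zs(3) I(3) potential_change_le[OF c] by simp
    note sat = saturated[OF zs(1) _ _ handled_append[OF I(2)] this]
    have closed: "\<And>k. k \<in> H \<Longrightarrow> k \<inter> (set xs \<union> g) \<noteq> {} \<Longrightarrow> k \<subseteq> set xs \<union> g"
      using sat s(1) I(4) unfolding zs(2) by simp
    obtain w where w: "w \<in> g" "w \<notin> set xs" using g(3) by blast
    obtain k where k: "k \<in> H" "k - set xs = {w}"
      using crossing_with_one_new_vertex[OF closed g(1) w] by blast
    have "card (g - set xs) < 2"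
      using no_single_new_vertex[OF s(2,1) k g(1) w(1)] by (rule_tac ccontr) simp
    moreover have "finite (g - set xs)" using H_props[OF g(1)] by simp
    then have "card (g - set xs) \<noteq> 0" using w by (metis DiffI card_0_eq empty_iff)
    ultimately have c1: "card (g - set xs) = 1" by linarith
    then have gw: "g - set xs = {w}" using w by (metis DiffI card_1_singletonE singletonD)
    have a3': "a = 3"
    proof (rule ccontr)
      assume "a \<noteq> 3"
      then have "card (g - set xs) + 3 \<le> a" using c1 a3 by simp
      then have "potential (xs @ zs, q, Suc e, Suc f) < 0"
        using zs(3) I(3) potential_change_le[of "card (g - set xs)" 3] a3 by simp
      moreover have "0 \<le> potential (xs @ zs, q, Suc e, Suc f)"
        using potential_nonneg[OF zs(1)] s(1) I(4) max_free_ge by simp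
      ultimately show False by simp
    qed
    \<comment> \<open>An edge crossing \<open>h\<close> in \<open>z\<close> must use the vertex \<open>w\<close>; otherwise it could be added to the tree without \<open>h\<close>.\<close>
    have cross: "\<exists>k\<in>H. h \<inter> k = {z} \<and> w \<in> k" if z: "z \<in> h - set ys" for z
    proof -
      obtain k where k: "k \<in> H" "h \<inter> k = {z}" using crossing_H[OF l(3)] z by blast
      have "k \<inter> (set xs \<union> g) \<noteq> {}" using k(2) l(5) by auto
      then have "k \<subseteq> set xs \<union> g" using closed[OF k(1)] by simp
      then have "k - set ys \<subseteq> {z, w}" using l(5) k(2) gw by auto
      moreover have "z \<in> k" using k(2) by auto
      ultimately have "k - set ys = {z}" if "w \<notin> k" using that z by auto
      then have "w \<in> k" using one[OF k(1)] z by blast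
      then show ?thesis using k by blast
    qed
    have "\<exists>z1 z2. z1 \<in> h - set ys \<and> z2 \<in> h - set ys \<and> z1 \<noteq> z2"
    proof -
      have "\<not> (\<exists>z. h - set ys \<subseteq> {z})"
      proof
        assume "\<exists>z. h - set ys \<subseteq> {z}"
        then obtain z where "h - set ys \<subseteq> {z}" by blast
        then have "card (h - set ys) \<le> card {z}" by (intro card_mono) auto
        then show False using l(4) by simp
      qed
      then show ?thesis by blast
    qed
    then obtain z1 z2 where z: "z1 \<in> h - set ys" "z2 \<in> h - set ys" "z1 \<noteq> z2" by blast
    obtain k1 k2 where k: "k1 \<in> H" "h \<inter> k1 = {z1}" "w \<in> k1" "k2 \<in> H" "h \<inter> k2 = {z2}" "w \<in> k2"
      using cross[OF z(1)] cross[OF z(2)] by blast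
    have "w \<notin> h" using w(2) l(5) by auto
    then show False using triangle_contradiction[OF a3' l(3) k(1,4) k(2,5) z(3) k(3,6)] by simp
  qed
qed

end

section \<open>Equations with different numbers of variables\<close>

text \<open>If \<open>a < b\<close>, edges of the first kind meet at no cost: attaching one to a known vertex changes the
potential by \<open>a - b < 0\<close>, so it can be done by a free move.  Attaching an edge of the second kind
increases the potential by \<open>b - a\<close> for each of its \<open>b - 1\<close> new vertices, which is compensated
by edges of the first kind through these vertices.\<close>

locale critical_pair_smaller = critical_pair +
  assumes smaller: "a < b"
begin

declare potential.simps [simp del]

text \<open>The last edge added was an edge \<open>h\<close> of the first kind, and the potential before adding it is
low enough for another edge with a single new vertex to make it negative.\<close>

definition fresh_link :: "nat \<Rightarrow> int list \<Rightarrow> bool" where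
  "fresh_link t xs \<longleftrightarrow> (\<exists>t1 ys r e1 f1 h. t1 \<le> t \<and> (ys, r, e1, f1) \<in> layer S t1 \<and>
     potential (ys, r, e1, f1) \<le> int b \<and> f1 \<le> a + b + 2 \<and> h \<in> P \<and> \<not> h \<subseteq> set ys \<and> set xs = set ys \<union> h)"

lemma fresh_link_mono: "fresh_link t xs \<Longrightarrow> t \<le> t' \<Longrightarrow> fresh_link t' xs"
  unfolding fresh_link_def using le_trans by blast

lemma max_free_ge: "a + b + 3 \<le> max_free"
  using a3 ab unfolding max_free_def by linarith

text \<open>These inequalities hold for \<open>3 \<le> a < b\<close> but fail for \<open>a = b = 3\<close>, where the configuration of
Pasch appears.\<close>

lemma size_gap: "2 * int a + int b < int a * int b" "int a + 2 * int b < int a * int b"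
proof -
  have "(int a - 3) * (int b - 4) \<ge> 0" using a3 smaller by (intro mult_nonneg_nonneg) auto
  then show "2 * int a + int b < int a * int b" "int a + 2 * int b < int a * int b"
    using a3 smaller by (simp_all add: algebra_simps)
qed

lemma no_single_new_vertex:
  assumes "(ys, r, e, f) \<in> layer S t" "t < T" "potential (ys, r, e, f) \<le> int b" "f \<le> a + b + 2"
    and h: "h \<in> H" "h - set ys = {z}"
  shows False
proof -
  have "\<not> h \<subseteq> set ys" using h(2) by auto
  from free_step_H[OF assms(1) h(1) this] obtain zs where
    zs: "(ys @ zs, r, Suc e, Suc f) \<in> layer S (Suc t)"
      "potential (ys @ zs, r, Suc e, Suc f)
         = potential (ys, r, e, f) + int b * int (card (h - set ys)) - int a * (int b - 1)"
    by blast
  have "potential (ys @ zs, r, Suc e, Suc f) < 0"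
    using zs(2) assms(3) size_gap(2) h(2) by (simp add: algebra_simps)
  moreover have "0 \<le> potential (ys @ zs, r, Suc e, Suc f)"
    using potential_nonneg[OF zs(1)] assms(2,4) max_free_ge by simp
  ultimately show False by simp
qed

context
  fixes g :: "int set" and E :: "int \<Rightarrow> int set"
  assumes g: "g \<in> Q" and E: "\<And>u. u \<in> g \<Longrightarrow> E u \<in> P \<and> g \<inter> E u = {u}"
begin

lemma E_card: "u \<in> g \<Longrightarrow> card (E u) = a \<and> finite (E u)"
  using E P_card H_props unfolding H_def by blast

lemma union_of_transversal:
  assumes "R \<subseteq> g"
  shows "\<exists>xs. (xs, 0, card R, card R) \<in> layer S (card R) \<and> set xs = (\<Union>u\<in>R. E u)"
proof -
  have "finite R" using assms H_props[of g] g finite_subset unfolding H_def by blast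
  then show ?thesis using assms
  proof (induction R rule: finite_induct)
    case (insert u R)
    then obtain xs where xs: "(xs, 0, card R, card R) \<in> layer S (card R)" "set xs = (\<Union>u\<in>R. E u)" by blast
    have u: "u \<in> g" using insert.prems by simp
    have "u \<notin> E v" if "v \<in> R" for v
    proof
      assume "u \<in> E v"
      then have "u \<in> g \<inter> E v" using u by simp
      then have "u = v" using E[of v] that insert.prems by auto
      then show False using that insert.hyps(2) by simp
    qed
    then have "u \<notin> set xs" unfolding xs(2) by auto
    moreover have "u \<in> E u" using E[OF u] by auto
    ultimately have "\<not> E u \<subseteq> set xs" by auto
    moreover have "E u \<in> H" using E[OF u] by (simp add: H_def)
    ultimately obtain ys where "(xs @ ys, 0, Suc (card R), Suc (card R)) \<in> layer S (Suc (card R))"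
      "set (xs @ ys) = set xs \<union> E u" using free_step_H[OF xs(1)] by blast
    moreover have "card (insert u R) = Suc (card R)" using insert.hyps by simp
    ultimately show ?case using xs(2) by (intro exI[of _ "xs @ ys"]) auto
  qed simp
qed

text \<open>If every vertex of these edges \<open>E u\<close> apart from \<open>u\<close> were covered twice, their union
would have at most \<open>card R * (a + 1) / 2\<close> vertices.  Such a union is too dense: each \<open>u\<close> is private to
its edge, so the edges can be added one after the other from scratch.\<close>

lemma private_vertex:
  assumes R: "R \<subseteq> g" "R \<noteq> {}"
  shows "\<exists>u\<in>R. \<not> E u - {u} \<subseteq> (\<Union>v\<in>R - {u}. E v)"
proof (rule ccontr)
  assume "\<not> (\<exists>u\<in>R. \<not> E u - {u} \<subseteq> (\<Union>v\<in>R - {u}. E v))"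
  then have cover: "E u - {u} \<subseteq> (\<Union>v\<in>R - {u}. E v)" if "u \<in> R" for u using that by blast
  have gfin: "finite g" and gb: "card g \<le> b" using H_props[of g] g by (auto simp: H_def)
  have fin: "finite R" using R gfin finite_subset by blast
  have Rb: "card R \<le> b" using card_mono[OF gfin R(1)] gb by simp
  have R1: "1 \<le> card R" using R(2) fin by (simp add: Suc_leI card_gt_0_iff)
  define V where "V = (\<Union>u\<in>R. E u - {u})"
  have finV: "finite V" using fin R(1) E_card unfolding V_def by blast
  define d where "d w = card {u \<in> R. w \<in> E u - {u}}" for w
  \<comment> \<open>Double counting of the pairs \<open>(u, w)\<close> with \<open>w\<close> in \<open>E u - {u}\<close>.\<close>
  have d2: "2 \<le> d w" if w: "w \<in> V" for w
  proof -
    obtain u where u: "u \<in> R" "w \<in> E u" "w \<noteq> u" using w by (auto simp: V_def)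
    then obtain v where v: "v \<in> R" "v \<noteq> u" "w \<in> E v" using cover[OF u(1)] by auto
    have "w \<notin> g"
    proof
      assume "w \<in> g"
      then have "w \<in> g \<inter> E u" using u(2) by simp
      then show False using E[of u] u(1,3) R(1) by auto
    qed
    then have "w \<noteq> v" using v(1) R(1) by auto
    then have "{u, v} \<subseteq> {u \<in> R. w \<in> E u - {u}}" using u v by auto
    then have "card {u, v} \<le> d w" unfolding d_def using fin by (intro card_mono) auto
    then show ?thesis using v(2) by simp
  qed
  have "2 * card V = (\<Sum>w\<in>V. 2)" by simp
  also have "\<dots> \<le> (\<Sum>w\<in>V. d w)" using d2 by (rule sum_mono)
  also have "\<dots> = (\<Sum>u\<in>R. card {w \<in> V. w \<in> E u - {u}})"
    unfolding d_def by (rule sum_multicount_gen[symmetric, OF fin finV]) simp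
  also have "\<dots> = (\<Sum>u\<in>R. a - 1)"
  proof (rule sum.cong[OF refl])
    fix u assume u: "u \<in> R"
    have "{w \<in> V. w \<in> E u - {u}} = E u - {u}" using u by (auto simp: V_def)
    moreover have "u \<in> E u" using E[of u] u R(1) by auto
    ultimately show "card {w \<in> V. w \<in> E u - {u}} = a - 1" using E_card[of u] u R(1) by auto
  qed
  finally have V: "2 * card V \<le> card R * (a - 1)" by simp
  obtain xs where xs: "(xs, 0, card R, card R) \<in> layer S (card R)" "set xs = (\<Union>u\<in>R. E u)"
    using union_of_transversal[OF R(1)] by blast
  have "length xs = card (set xs)" using layer_props[OF fin_S xs(1)] by (simp add: distinct_card)
  also have "\<dots> \<le> card (R \<union> V)" unfolding xs(2) by (intro card_mono) (use fin finV in \<open>auto simp: V_def\<close>)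
  also have "\<dots> \<le> card R + card V" by (rule card_Un_le)
  finally have "2 * length xs \<le> 2 * card R + card R * (a - 1)" using V by simp
  then have "int (2 * length xs) \<le> int (2 * card R + card R * (a - 1))" by (simp only: of_nat_le_iff)
  then have "2 * int (length xs) \<le> int (card R) * (int a + 1)"
    using a3 by (simp add: algebra_simps of_nat_diff)
  then have "int b * (2 * int (length xs)) \<le> int b * (int (card R) * (int a + 1))"
    by (intro mult_left_mono) auto
  then have "2 * potential (xs, 0, card R, card R) \<le> int (card R) * (2 * int a + int b - int a * int b)"
    by (simp add: potential.simps algebra_simps)
  also have "\<dots> < 0" using R1 size_gap(1) by (intro mult_pos_neg) auto
  finally have "potential (xs, 0, card R, card R) < 0" by simp
  moreover have "0 \<le> potential (xs, 0, card R, card R)"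
    using potential_nonneg[OF xs(1)] Rb T_large max_free_ge by simp
  ultimately show False by simp
qed

text \<open>By the previous lemma the edges \<open>E u\<close> can be added in an order in which each of them has a new
vertex.  One that meets no earlier vertex except \<open>u\<close> is added by a forced move and lowers the
potential by \<open>b - a\<close>; otherwise it has at most \<open>a - 2\<close> new vertices and lowers it by at least
one more, which pays for a free move.  The last conjunct describes the state before the last of
these edges was added.\<close>

lemma attach_transversal:
  assumes st: "(xs, q, e, f) \<in> layer S t" and isolated: "\<And>u. u \<in> g - set xs \<Longrightarrow> E u \<inter> set xs = {}"
    and st': "(xs @ zs, q, Suc e, f0) \<in> layer S (Suc t)" "set (xs @ zs) = set xs \<union> g" "length zs \<le> b"
    and R: "R \<subseteq> g - set xs"
  shows "\<exists>ys e' f'. (xs @ zs @ ys, q, e', f') \<in> layer S (Suc t + card R) \<and>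
    set (xs @ zs @ ys) = set xs \<union> g \<union> (\<Union>u\<in>R. E u) \<and> length ys \<le> card R * a \<and>
    f0 \<le> f' \<and> f' \<le> f0 + card R \<and>
    potential (xs @ zs @ ys, q, e', f') + int f'
      \<le> potential (xs @ zs, q, Suc e, f0) + int f0 - int (card R) * (int b - int a) \<and>
    (R \<noteq> {} \<longrightarrow> (\<exists>ys1 e1 f1 h. (ys1, q, e1, f1) \<in> layer S (t + card R) \<and>
      potential (ys1, q, e1, f1) + int f1
        \<le> potential (xs @ zs, q, Suc e, f0) + int f0 - (int (card R) - 1) * (int b - int a) \<and>
      f0 \<le> f1 \<and> f1 \<le> f0 + card R \<and> h \<in> P \<and> \<not> h \<subseteq> set ys1 \<and> set (xs @ zs @ ys) = set ys1 \<union> h))"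
  using R
proof (induction "card R" arbitrary: R)
  case 0
  have "finite R" using "0.prems" H_props[of g] g finite_subset unfolding H_def by blast
  then have "R = {}" using 0 by simp
  then show ?case using st' by (intro exI[of _ "[]"] exI[of _ "Suc e"] exI[of _ f0]) auto
next
  case (Suc n)
  have gfin: "finite g" "card g \<le> b" using H_props[of g] g by (auto simp: H_def)
  have finR: "finite R" using Suc.prems gfin finite_subset by blast
  have Rne: "R \<noteq> {}" using Suc.hyps(2) by auto
  have Rg: "R \<subseteq> g" using Suc.prems by auto
  obtain u where u: "u \<in> R" "\<not> E u - {u} \<subseteq> (\<Union>v\<in>R - {u}. E v)"
    using private_vertex[OF Rg Rne] by blast
  define R' where "R' = R - {u}"
  have cR': "card R' = n" using u(1) Suc.hyps(2) finR by (simp add: R'_def)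
  have "R' \<subseteq> g - set xs" using Suc.prems by (auto simp: R'_def)
  from Suc.hyps(1)[OF cR'[symmetric] this, unfolded cR'] obtain ys e' f' where
    I: "(xs @ zs @ ys, q, e', f') \<in> layer S (Suc t + n)"
      "set (xs @ zs @ ys) = set xs \<union> g \<union> (\<Union>u\<in>R'. E u)" "length ys \<le> n * a" "f0 \<le> f'" "f' \<le> f0 + n"
      "potential (xs @ zs @ ys, q, e', f') + int f'
        \<le> potential (xs @ zs, q, Suc e, f0) + int f0 - int n * (int b - int a)"
    by blast
  let ?ws = "xs @ zs @ ys"
  have ug: "u \<in> g" "u \<notin> set xs" using u(1) Suc.prems by auto
  have EP: "E u \<in> P" "g \<inter> E u = {u}" using E[OF ug(1)] by auto
  have EH: "E u \<in> H" using EP by (simp add: H_def)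
  have uE: "u \<in> E u" using EP(2) by auto
  have Exs: "E u \<inter> set xs = {}" using isolated ug by simp
  have new: "\<not> E u \<subseteq> set ?ws"
  proof -
    obtain w where w: "w \<in> E u" "w \<noteq> u" "w \<notin> (\<Union>v\<in>R'. E v)" using u(2) unfolding R'_def by blast
    have "w \<notin> g" using w EP(2) by auto
    moreover have "w \<notin> set xs" using w Exs by auto
    ultimately have "w \<notin> set ?ws" using w(3) unfolding I(2) by simp
    then show ?thesis using w(1) by auto
  qed
  have cE: "card (E u) = a" "finite (E u)" using E_card[OF ug(1)] by auto
  have uws: "u \<in> set ?ws" unfolding I(2) using ug by simp
  have gap: "int b - int a \<ge> 1" using smaller by simp
  have "\<exists>vs e'' f''. (?ws @ vs, q, e'', f'') \<in> layer S (Suc (Suc t + n)) \<and> set (?ws @ vs) = set ?ws \<union> E u \<and>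
      length vs \<le> a \<and> f' \<le> f'' \<and> f'' \<le> Suc f' \<and>
      potential (?ws @ vs, q, e'', f'') + int f'' \<le> potential (?ws, q, e', f') + int f' - (int b - int a)"
  proof (cases "E u \<inter> set ?ws = {u}")
    case True
    have "u \<in> set zs" using ug st'(2) by auto
    then obtain j where j: "j < length zs" "zs ! j = u" by (auto simp: in_set_conv_nth)
    let ?i = "length xs + j"
    have i: "?ws ! ?i = u" "?i < length ?ws" using j by (auto simp: nth_append)
    \<comment> \<open>The vertex \<open>u\<close> was added in this round, so it lies in the window and the move is forced.\<close>
    have "n \<le> b"
      using Suc.hyps(2) card_mono[OF gfin(1) Rg] gfin(2) by linarith
    then have "n * a \<le> a * b" by (simp add: mult.commute)
    then have "length ys \<le> a * b" using I(3) by (rule order_trans[rotated])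
    then have win: "length ?ws \<le> ?i + window" using st'(3) unfolding window_def by simp
    have "E u \<inter> set ?ws = {?ws ! ?i}" using True i(1) by simp
    from forced_step_H[OF I(1) EH this i(2) disjI2[OF win]] obtain vs where
      vs: "(?ws @ vs, q, Suc e', f') \<in> layer S (Suc (Suc t + n))" "set (?ws @ vs) = set ?ws \<union> E u"
        "length vs \<le> card (E u)"
        "potential (?ws @ vs, q, Suc e', f')
           = potential (?ws, q, e', f') + int b * int (card (E u) - 1) - int a * (int b - 1)" by blast
    have "int b * int (card (E u) - 1) - int a * (int b - 1) = - (int b - int a)"
      using cE(1) a3 by (simp add: of_nat_diff algebra_simps)
    then have "potential (?ws @ vs, q, Suc e', f') + int f' \<le> potential (?ws, q, e', f') + int f' - (int b - int a)"
      using vs(4) by simp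
    then show ?thesis using vs(1-3) cE(1) by (metis le_refl le_SucI)
  next
    case False
    have c: "card (E u - set ?ws) + 2 \<le> a"
      using new_card_le[OF cE(2) uE uws False] cE(1) by simp
    obtain vs where vs: "vs = sorted_list_of_set (E u - set ?ws)" by simp
    have E': "E u \<in> edges" "E u \<subseteq> S" using H_props[OF EH] by auto
    note fs = free_step[OF I(1) E' new refl, folded vs]
    have "length vs \<le> a" using vs cE card_mono[OF cE(2), of "E u - set ?ws"] by simp
    have "int b * int (card (E u - set ?ws)) \<le> int b * (int a - 2)" using c by (intro mult_left_mono) auto
    then have "int b * int (card (E u - set ?ws)) - int a * (int b - 1) + 1 \<le> - (int b - int a)"
      using smaller by (simp add: algebra_simps)
    then have "potential (?ws @ vs, q, Suc e', Suc f') + int (Suc f') \<le> potential (?ws, q, e', f') + int f' - (int b - int a)"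
      using fs(2) by simp
    then show ?thesis using fs(1,3) \<open>length vs \<le> a\<close> by (metis le_refl le_SucI)
  qed
  then obtain vs e'' f'' where vs: "(?ws @ vs, q, e'', f'') \<in> layer S (Suc (Suc t + n))"
    "set (?ws @ vs) = set ?ws \<union> E u" "length vs \<le> a" "f' \<le> f''" "f'' \<le> Suc f'"
    "potential (?ws @ vs, q, e'', f'') + int f'' \<le> potential (?ws, q, e', f') + int f' - (int b - int a)"
    by blast
  have cR: "card R = Suc n" using Suc.hyps(2) by simp
  have sets: "set (?ws @ vs) = set xs \<union> g \<union> (\<Union>u\<in>R. E u)"
    unfolding vs(2) I(2) using u(1) by (auto simp: R'_def)
  have pot: "potential (?ws @ vs, q, e'', f'') + int f''
     \<le> potential (xs @ zs, q, Suc e, f0) + int f0 - int (card R) * (int b - int a)"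
    using vs(6) I(6) unfolding cR by (simp add: algebra_simps)
  have link: "\<exists>ys1 e1 f1 h. (ys1, q, e1, f1) \<in> layer S (t + card R) \<and>
      potential (ys1, q, e1, f1) + int f1
        \<le> potential (xs @ zs, q, Suc e, f0) + int f0 - (int (card R) - 1) * (int b - int a) \<and>
      f0 \<le> f1 \<and> f1 \<le> f0 + card R \<and> h \<in> P \<and> \<not> h \<subseteq> set ys1 \<and> set (?ws @ vs) = set ys1 \<union> h"
    by (rule exI[of _ ?ws], rule exI[of _ e'], rule exI[of _ f'], rule exI[of _ "E u"])
      (use I EP(1) new vs(2) in \<open>simp add: cR\<close>)
  show ?case
    by (rule exI[of _ "ys @ vs"], rule exI[of _ e''], rule exI[of _ f''])
      (use vs sets pot link I in \<open>simp add: cR\<close>)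
qed

end

text \<open>The invariant at the end of a round.  Every free move after the first lowers the potential by at
least one, so the potential together with the number of free moves stays bounded.\<close>

definition good_state :: "nat \<Rightarrow> state \<Rightarrow> bool" where
  "good_state t = (\<lambda>(xs, q, e, f). (xs, q, e, f) \<in> layer S t \<and> handled H xs q \<and>
     potential (xs, q, e, f) + int f \<le> int a + 1 \<and> 1 \<le> f \<and> f \<le> a + 1 \<and> fresh_link t xs)"

lemma good_stateI:
  assumes "(xs, q, e, f) \<in> layer S t" "handled H xs q" "potential (xs, q, e, f) + int f \<le> int a + 1"
    and "1 \<le> f" "f \<le> a + b + 2" "t \<le> 2 * T" "fresh_link t xs"
  shows "good_state t (xs, q, e, f)"
proof -
  have "0 \<le> potential (xs, q, e, f)" using potential_nonneg[OF assms(1,6)] assms(5) max_free_ge by simp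
  then have "f \<le> a + 1" using assms(3) by linarith
  then show ?thesis using assms by (simp add: good_state_def)
qed

lemma good_start: "\<exists>s. good_state 1 s"
proof -
  obtain g where g: "g \<in> P" using P_nonempty by auto
  then have gH: "g \<in> H" by (simp add: H_def)
  have start: "([], 0, 0, 0) \<in> layer S 0" by simp
  have ne: "\<not> g \<subseteq> set []" using H_props[OF gH] by auto
  from free_step_H[OF start gH this] obtain xs where
    xs: "(xs, 0, 1, 1) \<in> layer S 1" "set xs = g"
      "potential (xs, 0, 1, 1) = int b * int (card g) - int a * (int b - 1)" by (auto simp: potential.simps)
  have "potential (xs, 0, 1, 1) + int 1 \<le> int a + 1" using xs(3) P_card[OF g] by (simp add: algebra_simps)
  moreover have "fresh_link 1 xs" unfolding fresh_link_def
    by (rule exI[of _ 0], rule exI[of _ "[]"], rule exI[of _ 0], rule exI[of _ 0], rule exI[of _ 0], rule exI[of _ g])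
      (use ne g xs(2) in \<open>simp add: potential.simps\<close>)
  ultimately have "good_state 1 (xs, 0, 1, 1)" using xs(1) T_large
    by (intro good_stateI) (auto simp: layer_handled_0)
  then show ?thesis by blast
qed

text \<open>An edge of the first kind that meets the known vertices has at most \<open>a - 1\<close> new ones, so it lowers
the potential by \<open>b - a\<close> or more, which pays for the free move.\<close>

lemma good_absorb:
  assumes s: "good_state t (xs, q, e, f)" "t < T" and h: "h \<in> P" "h \<inter> set xs \<noteq> {}" "\<not> h \<subseteq> set xs"
  shows "\<exists>s'. good_state (Suc t) s'"
proof -
  have I: "(xs, q, e, f) \<in> layer S t" "handled H xs q" "potential (xs, q, e, f) + int f \<le> int a + 1"
    "1 \<le> f" "f \<le> a + 1" using s(1) unfolding good_state_def by auto
  have hH: "h \<in> H" using h(1) by (simp add: H_def)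
  obtain ys where ys: "(xs @ ys, q, Suc e, Suc f) \<in> layer S (Suc t)" "set (xs @ ys) = set xs \<union> h"
    "potential (xs @ ys, q, Suc e, Suc f)
       = potential (xs, q, e, f) + int b * int (card (h - set xs)) - int a * (int b - 1)"
    using free_step_H[OF I(1) hH h(3)] by blast
  have "card (h - set xs) < card h" using h(2) H_props[OF hH] by (intro psubset_card_mono) auto
  then have "card (h - set xs) + 1 \<le> a" using P_card[OF h(1)] by simp
  then have "int b * int (card (h - set xs)) \<le> int b * (int a - 1)" by (intro mult_left_mono) auto
  then have "potential (xs @ ys, q, Suc e, Suc f) + int (Suc f) \<le> int a + 1"
    using ys(3) I(3) smaller by (simp add: algebra_simps)
  moreover have "fresh_link (Suc t) (xs @ ys)" unfolding fresh_link_def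
    by (rule exI[of _ t], rule exI[of _ xs], rule exI[of _ q], rule exI[of _ e], rule exI[of _ f], rule exI[of _ h])
      (use I h ys(2) smaller in simp)
  ultimately have "good_state (Suc t) (xs @ ys, q, Suc e, Suc f)"
    using ys(1) handled_append[OF I(2)] I(5) s(2) by (intro good_stateI) auto
  then show ?thesis by blast
qed

text \<open>Since no edge of the first kind meets the known vertices partially, those through the new vertices of
\<open>g\<close> are disjoint from them and can be attached as a transversal.  If \<open>g\<close> has \<open>m\<close> new
vertices, adding it raises the potential plus the number of free moves by at most \<open>m * (b - a)\<close>, and the
transversal lowers this sum by as much.\<close>

lemma good_block:
  assumes s: "good_state t (xs, q, e, f)" "t < T" and q: "q < length xs"
    and absorbed: "\<And>h. h \<in> P \<Longrightarrow> h \<inter> set xs \<noteq> {} \<Longrightarrow> h \<subseteq> set xs"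
    and g: "g \<in> Q" "xs ! q \<in> g" "\<not> g \<subseteq> set xs"
  shows "\<exists>t' s'. good_state t' s' \<and> t < t' \<and> t' \<le> t + (b + 1)"
proof -
  have I: "(xs, q, e, f) \<in> layer S t" "handled H xs q" "potential (xs, q, e, f) + int f \<le> int a + 1"
    "1 \<le> f" "f \<le> a + 1" using s(1) unfolding good_state_def by auto
  have gH: "g \<in> H" using g(1) by (simp add: H_def)
  have cg: "card g = b" "finite g" using Q_card[OF g(1)] H_props[OF gH] by auto
  have xq: "xs ! q \<in> set xs" using q by simp
  define m where "m = card (g - set xs)"
  have m1: "1 \<le> m" using g(3) cg(2) unfolding m_def by (simp add: Suc_leI card_gt_0_iff)
  have mb: "m \<le> b" using card_mono[OF cg(2), of "g - set xs"] cg(1) unfolding m_def by simp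
  have "\<exists>zs f0. (xs @ zs, q, Suc e, f0) \<in> layer S (Suc t) \<and> set (xs @ zs) = set xs \<union> g \<and> length zs \<le> b \<and>
      f \<le> f0 \<and> f0 \<le> Suc f \<and>
      potential (xs @ zs, q, Suc e, f0) + int f0 \<le> potential (xs, q, e, f) + int f + int m * (int b - int a)"
  proof (cases "g \<inter> set xs = {xs ! q}")
    case True
    from forced_step_H[OF I(1) gH True q disjI1[OF refl]] obtain zs where
      zs: "(xs @ zs, q, Suc e, f) \<in> layer S (Suc t)" "set (xs @ zs) = set xs \<union> g" "length zs \<le> card g"
        "potential (xs @ zs, q, Suc e, f)
           = potential (xs, q, e, f) + int b * int (card g - 1) - int a * (int b - 1)" by blast
    have "g - set xs = g - {xs ! q}" using True by blast
    then have "m = b - 1" using cg g(2) unfolding m_def by simp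
    then have "int b * int (card g - 1) - int a * (int b - 1) = int m * (int b - int a)"
      using cg(1) m1 by (simp add: of_nat_diff algebra_simps)
    then have "potential (xs @ zs, q, Suc e, f) + int f \<le> potential (xs, q, e, f) + int f + int m * (int b - int a)"
      using zs(4) by simp
    then show ?thesis using zs(1-3) cg(1) by (metis le_refl le_SucI)
  next
    case False
    have c: "m + 2 \<le> b" using new_card_le[OF cg(2) g(2) xq False] cg(1) by (simp add: m_def)
    have E': "g \<in> edges" "g \<subseteq> S" using H_props[OF gH] by auto
    note fs = free_step[OF I(1) E' g(3) refl]
    have len: "length (sorted_list_of_set (g - set xs)) \<le> b" using mb by (simp add: m_def)
    have "int a * (int m + 2) \<le> int a * int b" using c by (intro mult_left_mono) auto
    then have "int b * int m - int a * (int b - 1) + 1 \<le> int m * (int b - int a)"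
      using a3 by (simp add: algebra_simps)
    then have "potential (xs @ sorted_list_of_set (g - set xs), q, Suc e, Suc f) + int (Suc f)
        \<le> potential (xs, q, e, f) + int f + int m * (int b - int a)"
      using fs(2) by (simp add: m_def)
    then show ?thesis using fs(1,3) len by (metis le_refl le_SucI)
  qed
  then obtain zs f0 where zs: "(xs @ zs, q, Suc e, f0) \<in> layer S (Suc t)" "set (xs @ zs) = set xs \<union> g"
    "length zs \<le> b" "f \<le> f0" "f0 \<le> Suc f"
    "potential (xs @ zs, q, Suc e, f0) + int f0 \<le> potential (xs, q, e, f) + int f + int m * (int b - int a)"
    by blast
  have "\<forall>u\<in>g. \<exists>k. k \<in> P \<and> g \<inter> k = {u}" using crossing_Q[OF g(1)] by (simp add: Bex_def)
  then obtain E where E: "\<And>u. u \<in> g \<Longrightarrow> E u \<in> P \<and> g \<inter> E u = {u}" by (rule bchoice[THEN exE]) blast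
  have isolated: "E u \<inter> set xs = {}" if "u \<in> g - set xs" for u
  proof (rule ccontr)
    assume "E u \<inter> set xs \<noteq> {}"
    then have "E u \<subseteq> set xs" using absorbed[of "E u"] E[of u] that by blast
    moreover have "u \<in> E u" using E[of u] that by auto
    ultimately show False using that by auto
  qed
  have gxs: "card (g - set xs) = m" "g - set xs \<noteq> {}" using g(3) by (simp_all add: m_def)
  from attach_transversal[OF g(1) E I(1) isolated zs(1-3) order_refl, unfolded gxs(1)]
  obtain ys e' f' where
    ys: "(xs @ zs @ ys, q, e', f') \<in> layer S (Suc t + m)"
      "f0 \<le> f'" "f' \<le> f0 + m"
      "potential (xs @ zs @ ys, q, e', f') + int f'
        \<le> potential (xs @ zs, q, Suc e, f0) + int f0 - int m * (int b - int a)" and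
    "\<exists>ys1 e1 f1 h. (ys1, q, e1, f1) \<in> layer S (t + m) \<and>
      potential (ys1, q, e1, f1) + int f1
        \<le> potential (xs @ zs, q, Suc e, f0) + int f0 - (int m - 1) * (int b - int a) \<and>
      f0 \<le> f1 \<and> f1 \<le> f0 + m \<and> h \<in> P \<and> \<not> h \<subseteq> set ys1 \<and> set (xs @ zs @ ys) = set ys1 \<union> h"
    using gxs(2) by blast
  then obtain ys1 e1 f1 h where l: "(ys1, q, e1, f1) \<in> layer S (t + m)"
      "potential (ys1, q, e1, f1) + int f1
        \<le> potential (xs @ zs, q, Suc e, f0) + int f0 - (int m - 1) * (int b - int a)"
      "f0 \<le> f1" "f1 \<le> f0 + m" "h \<in> P" "\<not> h \<subseteq> set ys1" "set (xs @ zs @ ys) = set ys1 \<union> h" by blast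
  have "potential (ys1, q, e1, f1) + int f1 \<le> int a + 1 + (int b - int a)"
    using l(2) zs(6) I(3) by (simp add: algebra_simps)
  then have pb: "potential (ys1, q, e1, f1) \<le> int b" using l(3) zs(4) I(4) by linarith
  have fb: "f1 \<le> a + b + 2" using l(4) zs(5) I(5) mb by linarith
  have link: "fresh_link (Suc t + m) (xs @ zs @ ys)" unfolding fresh_link_def
    by (rule exI[of _ "t + m"], rule exI[of _ ys1], rule exI[of _ q], rule exI[of _ e1], rule exI[of _ f1],
        rule exI[of _ h]) (use l pb fb in simp)
  have "potential (xs @ zs @ ys, q, e', f') + int f' \<le> int a + 1" using ys(4) zs(6) I(3) by linarith
  moreover have "handled H (xs @ zs @ ys) q" using handled_append[OF I(2)] .
  moreover have "1 \<le> f'" "f' \<le> a + b + 2" using ys(2,3) zs(4,5) I(4,5) mb by linarith+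
  moreover have "Suc t + m \<le> 2 * T" using s(2) mb T_large by linarith
  ultimately have "good_state (Suc t + m) (xs @ zs @ ys, q, e', f')"
    using ys(1) link by (intro good_stateI)
  then show ?thesis
    by (rule_tac exI[of _ "Suc t + m"], rule_tac exI) (use mb in auto)
qed

text \<open>Rounds are repeated until the exploration is complete; then an edge crossing the last edge of the
first kind makes the potential negative.\<close>

theorem contradiction_smaller: False
proof -
  obtain s0 where s0: "good_state 1 s0" using good_start by blast
  have "\<exists>t s. t < T \<and> good_state t s \<and> (\<lambda>(xs, q, e, f). q = length xs) s"
  proof (rule run_until_final[where Inv = good_state and d = "b + 1", OF s0])
    show "1 \<le> T + (b + 1)" by simp
  next
    fix t s assume s: "good_state t s" "T \<le> t" "t \<le> T + (b + 1)"
    obtain xs q e f where s': "s = (xs, q, e, f)" by (cases s) auto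
    have I: "(xs, q, e, f) \<in> layer S t" "potential (xs, q, e, f) + int f \<le> int a + 1" "1 \<le> f" "f \<le> a + 1"
      using s(1) unfolding s' good_state_def by auto
    have "int a < potential (xs, q, e, f)"
      using potential_late[OF I(1) s(2)] s(3) T_large I(4) max_free_ge by simp
    then show False using I(2,3) by simp
  next
    fix t s assume s: "good_state t s" "t < T" "\<not> (\<lambda>(xs, q, e, f). q = length xs) s"
    obtain xs q e f where s': "s = (xs, q, e, f)" by (cases s) auto
    note s'' = s(1)[unfolded s']
    have I: "(xs, q, e, f) \<in> layer S t" "handled H xs q" "potential (xs, q, e, f) + int f \<le> int a + 1"
      "1 \<le> f" "f \<le> a + 1" "fresh_link t xs" using s'' unfolding good_state_def by auto
    have q: "q < length xs" using I(2) s(3) unfolding s' handled_def by auto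
    consider (absorb) h where "h \<in> P" "h \<inter> set xs \<noteq> {}" "\<not> h \<subseteq> set xs"
      | (block) g where "\<forall>h\<in>P. h \<inter> set xs \<noteq> {} \<longrightarrow> h \<subseteq> set xs" "g \<in> H" "xs ! q \<in> g" "\<not> g \<subseteq> set xs"
      | (advance) "\<forall>g\<in>H. xs ! q \<in> g \<longrightarrow> g \<subseteq> set xs"
      by blast
    then show "\<exists>t' s'. good_state t' s' \<and> t < t' \<and> t' \<le> t + (b + 1)"
    proof cases
      case absorb
      then obtain s1 where "good_state (Suc t) s1" using good_absorb[OF s'' s(2)] by blast
      then show ?thesis by (rule_tac exI[of _ "Suc t"], rule_tac exI[of _ s1]) simp
    next
      case block
      have "g \<inter> set xs \<noteq> {}" using block(3) q by auto
      then have "g \<in> Q" using block(1,2,4) unfolding H_def by auto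
      then show ?thesis using good_block[OF s'' s(2) q _ _ block(3,4)] block(1) by blast
    next
      case advance
      have "handled H xs (Suc q)" using handled_Suc[OF I(2) q] advance by blast
      moreover have "(xs, Suc q, e, f) \<in> layer S (Suc t)" by (rule advance_step[OF I(1) q])
      moreover have "potential (xs, Suc q, e, f) = potential (xs, q, e, f)" by (simp add: potential.simps)
      moreover have "fresh_link (Suc t) xs" using fresh_link_mono[OF I(6)] by simp
      ultimately have "good_state (Suc t) (xs, Suc q, e, f)"
        using I(3-5) s(2) by (intro good_stateI) auto
      then show ?thesis by (rule_tac exI[of _ "Suc t"], rule_tac exI) auto
    qed
  qed
  then obtain t xs q e f where fin: "t < T" "good_state t (xs, q, e, f)" "q = length xs" by auto
  have I: "handled H xs (length xs)" "fresh_link t xs" using fin(2,3) unfolding good_state_def by auto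
  obtain t1 ys r e1 f1 h where l: "t1 \<le> t" "(ys, r, e1, f1) \<in> layer S t1"
     "potential (ys, r, e1, f1) \<le> int b" "f1 \<le> a + b + 2" "h \<in> P" "\<not> h \<subseteq> set ys" "set xs = set ys \<union> h"
    using I(2) unfolding fresh_link_def by blast
  have hH: "h \<in> H" using l(5) by (simp add: H_def)
  obtain z where z: "z \<in> h" "z \<notin> set ys" using l(6) by blast
  have closed: "\<And>g. g \<in> H \<Longrightarrow> g \<inter> (set ys \<union> h) \<noteq> {} \<Longrightarrow> g \<subseteq> set ys \<union> h"
    using handled_all[OF I(1)] l(7) by simp
  obtain k where k: "k \<in> H" "k - set ys = {z}"
    using crossing_with_one_new_vertex[OF closed hH z] by (rule bexE)
  have "t1 < T" using l(1) fin(1) by simp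
  from no_single_new_vertex[OF l(2) this l(3,4) k] show False .
qed

end

section \<open>The threshold\<close>

context two_equations
begin

theorem uncolourable_imp_unlikely:
  assumes fin: "finite S" and T: "b + 1 < T"
    and unc: "uncolourable {g \<in> solution_sets a \<alpha>. g \<subseteq> S} {g \<in> solution_sets b \<beta>. g \<subseteq> S}"
  shows "unlikely S T"
proof (rule ccontr)
  assume likely: "\<not> unlikely S T"
  have "finite {g \<in> solution_sets a \<alpha>. g \<subseteq> S}" "finite {g \<in> solution_sets b \<beta>. g \<subseteq> S}"
    by (rule finite_subset[of _ "Pow S"], use fin in auto)+
  from critical_exists[OF this unc] obtain P Q where
    PQ: "P \<subseteq> {g \<in> solution_sets a \<alpha>. g \<subseteq> S}" "Q \<subseteq> {g \<in> solution_sets b \<beta>. g \<subseteq> S}" "critical P Q"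
    by (elim exE conjE)
  interpret critical_pair a b \<alpha> \<beta> S P Q T
    by unfold_locales (use PQ fin T likely in auto)
  show False
  proof (cases "a < b")
    case True
    then interpret critical_pair_smaller a b \<alpha> \<beta> S P Q T by unfold_locales
    show False by (rule contradiction_smaller)
  next
    case False
    then interpret critical_pair_same_size a b \<alpha> \<beta> S P Q T using ab by unfold_locales simp
    show False by (rule contradiction_same_size)
  qed
qed

text \<open>The exponent \<open>y\<close> of the introduction: at the threshold the random set has about
\<open>n powr size_exp\<close> elements.\<close>

definition size_exp :: real where
  "size_exp = real b / (real a * (real b - 1))"

definition gap :: real where
  "gap = 1 / (real a * (real b - 1))"

lemma gap_pos: "0 < gap"
  using a3 ab by (simp add: gap_def)

lemma potential_gap: "of_int (potential (xs, q, e, f)) * gap = size_exp * real (length xs) - real e"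
  using a3 ab by (simp add: gap_def size_exp_def field_simps)

text \<open>This undoes the normalisation of the weight: the potential controls its factor
\<open>n powr (e - y * length xs)\<close>, and the number of free moves controls \<open>D ^ f\<close>.\<close>

lemma prob_le_weight:
  assumes n: "1 \<le> n" and p: "0 \<le> p" and \<delta>: "0 \<le> \<delta>" and q: "q \<le> length xs"
    and pot: "potential (xs, q, e, f) \<le> w" and f: "f \<le> F"
  shows "p ^ length xs \<le> weight n (2 * p * real n powr (- size_exp)) (real n powr (- \<delta>)) (xs, q, e, f)
           * real n powr (of_int w * gap + \<delta> * real F)"
proof -
  let ?l = "real (length xs)" and ?n = "real n"
  have n0: "0 < ?n" using n by simp
  have "of_int (potential (xs, q, e, f)) * gap \<le> of_int w * gap"
    using pot gap_pos by (intro mult_right_mono) (auto simp del: potential.simps)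
  then have "0 \<le> - size_exp * ?l + real e - \<delta> * real f + (of_int w * gap + \<delta> * real F)"
    using potential_gap[of xs q e f] mult_left_mono[of "real f" "real F" \<delta>] f \<delta>
    by (simp del: potential.simps)
  then have one: "1 \<le> ?n powr (- size_exp * ?l + real e - \<delta> * real f + (of_int w * gap + \<delta> * real F))"
    using n by (intro ge_one_powr_ge_zero) auto
  have two: "(1::real) \<le> 2 ^ length xs * (1 / 2) ^ q"
    using q by (simp add: power_one_over divide_simps power_increasing)
  have "weight n (2 * p * ?n powr (- size_exp)) (?n powr (- \<delta>)) (xs, q, e, f) * ?n powr (of_int w * gap + \<delta> * real F)
     = p ^ length xs * (2 ^ length xs * (1 / 2) ^ q)
        * ((?n powr (- size_exp)) ^ length xs * ?n ^ e * (?n powr (- \<delta>)) ^ f * ?n powr (of_int w * gap + \<delta> * real F))"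
    by (simp add: power_mult_distrib)
  also have "(?n powr (- size_exp)) ^ length xs = ?n powr (- size_exp * ?l)" using n0 by (simp add: powr_powr flip: powr_realpow)
  also have "?n ^ e = ?n powr real e" using n0 by (simp add: powr_realpow)
  also have "(?n powr (- \<delta>)) ^ f = ?n powr (- \<delta> * real f)" using n0 by (simp add: powr_powr flip: powr_realpow)
  also have "?n powr (- size_exp * ?l) * ?n powr real e * ?n powr (- \<delta> * real f) * ?n powr (of_int w * gap + \<delta> * real F)
     = ?n powr (- size_exp * ?l + real e - \<delta> * real f + (of_int w * gap + \<delta> * real F))"
    by (simp add: powr_add[symmetric])
  finally have *: "weight n (2 * p * ?n powr (- size_exp)) (?n powr (- \<delta>)) (xs, q, e, f) * ?n powr (of_int w * gap + \<delta> * real F)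
     = p ^ length xs * (2 ^ length xs * (1 / 2) ^ q)
        * ?n powr (- size_exp * ?l + real e - \<delta> * real f + (of_int w * gap + \<delta> * real F))" .
  have "p ^ length xs * 1 * 1 \<le> p ^ length xs * (2 ^ length xs * (1 / 2) ^ q)
        * ?n powr (- size_exp * ?l + real e - \<delta> * real f + (of_int w * gap + \<delta> * real F))"
    using one two p by (intro mult_mono) auto
  then show ?thesis unfolding * by simp
qed

definition unlikely_states :: "nat \<Rightarrow> int \<Rightarrow> nat \<Rightarrow> state set" where
  "unlikely_states n w t = {s \<in> layer {1..int n} t. potential s \<le> w \<and> snd (snd (snd s)) \<le> max_free}"

lemma unlikely_states_prob:
  assumes n: "1 \<le> n" and p: "0 \<le> p" and \<delta>: "0 \<le> \<delta>"
    and \<kappa>: "2 * p * real n powr (1 - size_exp) \<le> \<kappa>" "\<kappa> \<le> 1"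
    and c1: "2 * (real window + 1) * 2 ^ b * \<kappa> \<le> 1 / 8"
    and c2: "2 * real b * 2 ^ b * (real L + 1) ^ b * real n powr (- \<delta>) \<le> 1 / 8"
    and t: "t * b \<le> L"
  shows "(\<Sum>s\<in>unlikely_states n w t. p ^ card (set (fst s))) \<le> (3 / 4) ^ t * real n powr (of_int w * gap + \<delta> * real max_free)"
proof -
  let ?P = "2 * p * real n powr (- size_exp)" and ?D = "real n powr (- \<delta>)" and ?U = "{1..int n}"
  let ?c = "real n powr (of_int w * gap + \<delta> * real max_free)"
  have P: "0 \<le> ?P" using p by simp
  have "real n * ?P = 2 * p * real n powr (1 - size_exp)" using n by (simp add: powr_diff powr_minus divide_simps)
  then have P2: "real n * ?P \<le> \<kappa>" using \<kappa>(1) by (simp only:)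
  have fin: "finite (layer ?U t)" by (simp add: finite_layer)
  have "(\<Sum>s\<in>unlikely_states n w t. p ^ card (set (fst s))) \<le> (\<Sum>s\<in>unlikely_states n w t. weight n ?P ?D s * ?c)"
  proof (rule sum_mono)
    fix s assume s: "s \<in> unlikely_states n w t"
    obtain xs q e f where s': "s = (xs, q, e, f)" by (cases s) auto
    have "(xs, q, e, f) \<in> layer ?U t" "potential (xs, q, e, f) \<le> w" "f \<le> max_free"
      using s unfolding unlikely_states_def s' by auto
    moreover from this(1) have "distinct xs" "q \<le> length xs" using layer_props[of ?U] by auto
    ultimately show "p ^ card (set (fst s)) \<le> weight n ?P ?D s * ?c"
      using prob_le_weight[OF n p \<delta>, of q xs e f w max_free] unfolding s' by (simp add: distinct_card)
  qed
  also have "\<dots> \<le> (\<Sum>s\<in>layer ?U t. weight n ?P ?D s * ?c)"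
    using fin P by (intro sum_mono2) (auto simp: unlikely_states_def weight_nonneg simp del: weight.simps)
  also have "\<dots> = (\<Sum>s\<in>layer ?U t. weight n ?P ?D s) * ?c" by (simp add: sum_distrib_right)
  also have "\<dots> \<le> (3 / 4) ^ t * ?c"
    using layer_weight[OF P P2 \<kappa>(2) n _ c1 c2 t] by (intro mult_right_mono) auto
  finally show ?thesis .
qed

lemma geometric_sum_le: "(\<Sum>t\<in>{i..j}. (3 / 4 :: real) ^ t) \<le> 4 * (3 / 4) ^ i"
proof (cases "i \<le> j")
  case True
  have "(\<Sum>t\<in>{i..j}. (3 / 4 :: real) ^ t) = 4 * ((3 / 4) ^ i - (3 / 4) ^ Suc j)"
    using True by (simp add: sum_gp)
  then show ?thesis by simp
qed simp

lemma prob_unlikely: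
  assumes n: "1 \<le> n" and p: "0 \<le> p" "p \<le> 1" and \<delta>: "0 \<le> \<delta>"
    and \<kappa>: "2 * p * real n powr (1 - size_exp) \<le> \<kappa>" "\<kappa> \<le> 1"
    and c1: "2 * (real window + 1) * 2 ^ b * \<kappa> \<le> 1 / 8"
    and c2: "2 * real b * 2 ^ b * (real (2 * T * b) + 1) ^ b * real n powr (- \<delta>) \<le> 1 / 8"
  shows "measure_pmf.prob (random_subset n p) {S. unlikely S T}
           \<le> 4 * real n powr (- gap + \<delta> * real max_free) + 4 * (3 / 4) ^ T * real n powr (real a * gap + \<delta> * real max_free)"
    (is "_ \<le> 4 * ?A + 4 * (3 / 4) ^ T * ?B")
proof -
  let ?U = "{1..int n}"
  define Q1 where "Q1 = (\<Union>t\<in>{0..2 * T}. unlikely_states n (-1) t)"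
  define Q2 where "Q2 = (\<Union>t\<in>{T..2 * T}. unlikely_states n (int a) t)"
  have finS: "finite (unlikely_states n w t)" for w t by (simp add: unlikely_states_def finite_layer)
  have finQ: "finite Q1" "finite Q2" by (auto simp: Q1_def Q2_def finS)
  have "measure_pmf.prob (random_subset n p) {S. unlikely S T}
      \<le> measure_pmf.prob (random_subset n p) {S. \<exists>s\<in>Q1 \<union> Q2. set (fst s) \<subseteq> S}"
  proof (rule measure_pmf.finite_measure_mono_AE)
    show "AE S in random_subset n p. S \<in> {S. unlikely S T} \<longrightarrow> S \<in> {S. \<exists>s\<in>Q1 \<union> Q2. set (fst s) \<subseteq> S}"
    proof (unfold AE_measure_pmf_iff, intro ballI impI)
      fix S assume S: "S \<in> set_pmf (random_subset n p)" "S \<in> {S. unlikely S T}"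
      have SU: "S \<subseteq> ?U" using random_subset_subset[OF S(1)] .
      then have finS: "finite S" using finite_subset by blast
      obtain t xs q e f where s: "(xs, q, e, f) \<in> layer S t" "t \<le> 2 * T" "f \<le> max_free"
        "potential (xs, q, e, f) < 0 \<or> T \<le> t \<and> potential (xs, q, e, f) \<le> int a"
        using S(2) unfolding unlikely_def by blast
      have "(xs, q, e, f) \<in> layer ?U t" using layer_mono[OF SU] s(1) by blast
      then have "(xs, q, e, f) \<in> unlikely_states n (-1) t \<or> T \<le> t \<and> (xs, q, e, f) \<in> unlikely_states n (int a) t"
        using s(3,4) unfolding unlikely_states_def by auto
      then have "(xs, q, e, f) \<in> Q1 \<union> Q2" using s(2) unfolding Q1_def Q2_def by auto
      moreover have "set xs \<subseteq> S" using layer_props[OF finS s(1)] by blast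
      ultimately show "S \<in> {S. \<exists>s\<in>Q1 \<union> Q2. set (fst s) \<subseteq> S}" by force
    qed
  qed simp
  also have "\<dots> \<le> (\<Sum>s\<in>Q1 \<union> Q2. p ^ card (set (fst s)))"
  proof (rule prob_random_subset_some_superset[OF p])
    show "finite (Q1 \<union> Q2)" using finQ by simp
    fix s assume s: "s \<in> Q1 \<union> Q2"
    obtain xs q e f where s': "s = (xs, q, e, f)" by (cases s) auto
    obtain t where "(xs, q, e, f) \<in> layer ?U t"
      using s unfolding Q1_def Q2_def unlikely_states_def s' by auto
    then show "set (fst s) \<subseteq> ?U" using layer_props[of ?U xs q e f t] s' by simp
  qed
  also have "\<dots> \<le> (\<Sum>s\<in>Q1. p ^ card (set (fst s))) + (\<Sum>s\<in>Q2. p ^ card (set (fst s)))"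
    by (rule sum_Un_le[OF finQ]) (use p in simp)
  also have "\<dots> \<le> 4 * ?A + 4 * (3 / 4) ^ T * ?B"
  proof (rule add_mono)
    have bound: "(\<Sum>s\<in>unlikely_states n w t. p ^ card (set (fst s)))
        \<le> (3 / 4) ^ t * real n powr (of_int w * gap + \<delta> * real max_free)" if "t \<le> 2 * T" for w t
      by (rule unlikely_states_prob[OF n p(1) \<delta> \<kappa> c1 c2]) (use that in simp)
    have "(\<Sum>s\<in>Q1. p ^ card (set (fst s))) \<le> (\<Sum>t\<in>{0..2 * T}. \<Sum>s\<in>unlikely_states n (-1) t. p ^ card (set (fst s)))"
      unfolding Q1_def by (rule sum_UN_le) (use p finS in auto)
    also have "\<dots> \<le> (\<Sum>t\<in>{0..2 * T}. (3 / 4) ^ t * ?A)"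
      using bound[of _ "-1"] by (intro sum_mono) simp
    also have "\<dots> = (\<Sum>t\<in>{0..2 * T}. (3 / 4) ^ t) * ?A" by (simp add: sum_distrib_right)
    also have "\<dots> \<le> 4 * (3 / 4) ^ 0 * ?A" by (intro mult_right_mono geometric_sum_le) simp
    finally show "(\<Sum>s\<in>Q1. p ^ card (set (fst s))) \<le> 4 * ?A" by simp
    have "(\<Sum>s\<in>Q2. p ^ card (set (fst s))) \<le> (\<Sum>t\<in>{T..2 * T}. \<Sum>s\<in>unlikely_states n (int a) t. p ^ card (set (fst s)))"
      unfolding Q2_def by (rule sum_UN_le) (use p finS in auto)
    also have "\<dots> \<le> (\<Sum>t\<in>{T..2 * T}. (3 / 4) ^ t * ?B)"
      using bound[of _ "int a"] by (intro sum_mono) simp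
    also have "\<dots> = (\<Sum>t\<in>{T..2 * T}. (3 / 4) ^ t) * ?B" by (simp add: sum_distrib_right)
    also have "\<dots> \<le> 4 * (3 / 4) ^ T * ?B" by (intro mult_right_mono geometric_sum_le) simp
    finally show "(\<Sum>s\<in>Q2. p ^ card (set (fst s))) \<le> 4 * (3 / 4) ^ T * ?B" .
  qed
  finally show ?thesis .
qed

text \<open>With \<open>(ln n)\<^sup>2\<close> steps the geometric decay beats every power of \<open>n\<close>, while the number of vertices
remains polylogarithmic, so that a free move costs less than any positive power of \<open>n\<close>.  As
potentials are integers, a negative one leaves a factor \<open>n powr (- gap)\<close>, half of which pays for the
free moves.\<close>

theorem prob_unlikely_tendsto_0:
  "\<exists>c>0. \<forall>p :: nat \<Rightarrow> real. (\<forall>n\<ge>1. 0 \<le> p n \<and> p n \<le> 1 \<and> p n < c * real n powr (size_exp - 1)) \<longrightarrow>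
     (\<forall>T0. \<exists>T :: nat \<Rightarrow> nat. (\<forall>n. T0 < T n) \<and>
       (\<lambda>n. measure_pmf.prob (random_subset n (p n)) {S. unlikely S (T n)}) \<longlonglongrightarrow> 0)"
proof -
  define K where "K = 16 * (real window + 1) * 2 ^ b"
  have "1 \<le> (real window + 1) * 2 ^ b" using mult_mono[of 1 "real window + 1" 1 "2 ^ b"] by simp
  then have K: "1 \<le> K" "0 < K" unfolding K_def mult.assoc by linarith+
  \<comment> \<open>This choice makes the forced moves contribute at most \<open>1 / 8\<close>; the factor 2 in \<open>c = \<kappa> / 2\<close> comes from the weight.\<close>
  define \<kappa> where "\<kappa> = 1 / K"
  have \<kappa>: "\<kappa> \<le> 1" "0 < \<kappa>" "2 * (real window + 1) * 2 ^ b * \<kappa> \<le> 1 / 8"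
    using K by (auto simp: \<kappa>_def K_def divide_simps)
  define \<delta> where "\<delta> = gap / (2 * real max_free)"
  have mf: "0 < real max_free" by (simp add: max_free_def)
  have \<delta>: "0 < \<delta>" "\<delta> * real max_free = gap / 2" using mf gap_pos by (simp_all add: \<delta>_def)
  have b0: "0 < b" using a3 ab by simp
  show ?thesis
  proof (intro exI[of _ "\<kappa> / 2"] conjI allI impI)
    show "0 < \<kappa> / 2" using \<kappa> by simp
    fix p :: "nat \<Rightarrow> real" and T0 :: nat
    assume p: "\<forall>n\<ge>1. 0 \<le> p n \<and> p n \<le> 1 \<and> p n < \<kappa> / 2 * real n powr (size_exp - 1)"
    define T where "T n = T0 + 1 + nat \<lceil>(ln (real n))\<^sup>2\<rceil>" for n
    define G where "G n = 4 * real n powr (- gap + \<delta> * real max_free)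
        + 4 * (3 / 4) ^ T n * real n powr (real a * gap + \<delta> * real max_free)" for n
    have T_ge: "(ln (real n))\<^sup>2 \<le> real (T n)" for n unfolding T_def by linarith
    have T_le: "real (T n) \<le> real T0 + 2 + (ln (real n))\<^sup>2" for n
    proof -
      have "0 \<le> (ln (real n))\<^sup>2" by simp
      then show ?thesis unfolding T_def by linarith
    qed
    have "(\<lambda>n. measure_pmf.prob (random_subset n (p n)) {S. unlikely S (T n)}) \<longlonglongrightarrow> 0"
    proof (rule tendsto_sandwich[of "\<lambda>_. 0" _ _ G])
      show "\<forall>\<^sub>F n in sequentially. 0 \<le> measure_pmf.prob (random_subset n (p n)) {S. unlikely S (T n)}" by simp
      show "(\<lambda>_. 0) \<longlonglongrightarrow> (0 :: real)" by simp
      have "\<forall>\<^sub>F n in sequentially. 2 * real b * 2 ^ b * (real (2 * T n * b) + 1) ^ b * real n powr (- \<delta>) \<le> 1 / 8"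
      proof -
        define c where "c = \<delta> / real b"
        have c: "0 < c" using \<delta> b0 by (simp add: c_def)
        define h where "h n = (2 * (real T0 + 2 + (ln (real n))\<^sup>2) * real b + 1) * real n powr (- c)" for n :: nat
        have "h \<longlonglongrightarrow> 0" unfolding h_def using c by real_asymp
        then have "(\<lambda>n. 2 * real b * 2 ^ b * h n ^ b) \<longlonglongrightarrow> 2 * real b * 2 ^ b * 0 ^ b" by (intro tendsto_intros)
        moreover have "2 * real b * 2 ^ b * (0 :: real) ^ b = 0" using b0 by simp
        ultimately have "(\<lambda>n. 2 * real b * 2 ^ b * h n ^ b) \<longlonglongrightarrow> 0" by (simp only:)
        then have "\<forall>\<^sub>F n in sequentially. 2 * real b * 2 ^ b * h n ^ b < 1 / 8"
          by (rule order_tendstoD) simp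
        then show ?thesis
        proof (rule eventually_mono[OF eventually_conj[OF _ eventually_gt_at_top[of 0]]])
          fix n :: nat assume n: "2 * real b * 2 ^ b * h n ^ b < 1 / 8 \<and> 0 < n"
          have "real n powr (- \<delta>) = (real n powr (- c)) ^ b"
            using n b0 by (simp add: c_def powr_powr flip: powr_realpow)
          moreover have "(real (2 * T n * b) + 1) ^ b \<le> (2 * (real T0 + 2 + (ln (real n))\<^sup>2) * real b + 1) ^ b"
            using T_le[of n] by (intro power_mono) (auto intro!: mult_right_mono)
          ultimately have "(real (2 * T n * b) + 1) ^ b * real n powr (- \<delta>) \<le> h n ^ b"
            unfolding h_def power_mult_distrib by (simp add: mult_right_mono)
          then have "2 * real b * 2 ^ b * ((real (2 * T n * b) + 1) ^ b * real n powr (- \<delta>)) \<le> 2 * real b * 2 ^ b * h n ^ b"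
            by (intro mult_left_mono) auto
          then show "2 * real b * 2 ^ b * (real (2 * T n * b) + 1) ^ b * real n powr (- \<delta>) \<le> 1 / 8"
            using n unfolding mult.assoc by (elim conjE) (rule order_trans, assumption, rule less_imp_le)
        qed
      qed
      then show "\<forall>\<^sub>F n in sequentially. measure_pmf.prob (random_subset n (p n)) {S. unlikely S (T n)} \<le> G n"
      proof (rule eventually_mono[OF eventually_conj[OF _ eventually_gt_at_top[of 0]]])
        fix n :: nat
        assume n: "2 * real b * 2 ^ b * (real (2 * T n * b) + 1) ^ b * real n powr (- \<delta>) \<le> 1 / 8 \<and> 0 < n"
        have n1: "1 \<le> n" using n by simp
        have pn: "0 \<le> p n" "p n \<le> 1" "p n \<le> \<kappa> / 2 * real n powr (size_exp - 1)" using p n1 by (auto intro: less_imp_le)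
        have "2 * p n * real n powr (1 - size_exp) \<le> 2 * (\<kappa> / 2 * real n powr (size_exp - 1)) * real n powr (1 - size_exp)"
          using pn by (intro mult_right_mono mult_left_mono) auto
        also have "\<dots> = \<kappa> * (real n powr (size_exp - 1) * real n powr (1 - size_exp))" by simp
        also have "\<dots> = \<kappa>" using n by (simp add: powr_add[symmetric])
        finally show "measure_pmf.prob (random_subset n (p n)) {S. unlikely S (T n)} \<le> G n"
          unfolding G_def using n by (intro prob_unlikely[OF n1 pn(1,2) _ _ \<kappa>(1,3)]) (use \<delta> in auto)
      qed
      show "G \<longlonglongrightarrow> 0"
      proof (rule tendsto_sandwich[of "\<lambda>_. 0" _ _ "\<lambda>n. 4 * real n powr (- gap / 2)
          + 4 * ((3 / 4) powr ((ln (real n))\<^sup>2) * real n powr (real a * gap + gap / 2))"])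
        show "\<forall>\<^sub>F n in sequentially. 0 \<le> G n" by (simp add: G_def)
        have "(3 / 4 :: real) ^ T n \<le> (3 / 4) powr ((ln (real n))\<^sup>2)" for n
        proof -
          have "(3 / 4 :: real) ^ T n = (3 / 4) powr real (T n)" by (simp add: powr_realpow)
          also have "\<dots> \<le> (3 / 4) powr ((ln (real n))\<^sup>2)" using T_ge by (intro powr_mono') auto
          finally show ?thesis .
        qed
        then have "(3 / 4 :: real) ^ T n * real n powr (real a * gap + gap / 2)
            \<le> (3 / 4) powr ((ln (real n))\<^sup>2) * real n powr (real a * gap + gap / 2)" for n
          by (intro mult_right_mono) auto
        then show "\<forall>\<^sub>F n in sequentially. G n \<le> 4 * real n powr (- gap / 2)
          + 4 * ((3 / 4) powr ((ln (real n))\<^sup>2) * real n powr (real a * gap + gap / 2))"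
          unfolding G_def \<delta>(2) by (intro always_eventually allI add_mono) (auto simp: mult.assoc)
        define u where "u = real a * gap + gap / 2"
        have "(\<lambda>n. (3 / 4) powr ((ln (real n))\<^sup>2) * real n powr u) \<longlonglongrightarrow> 0" by real_asymp
        moreover have "(\<lambda>n. real n powr (- gap / 2)) \<longlonglongrightarrow> 0" using gap_pos by real_asymp
        ultimately have "(\<lambda>n. 4 * real n powr (- gap / 2) + 4 * ((3 / 4) powr ((ln (real n))\<^sup>2) * real n powr u)) \<longlonglongrightarrow> 4 * 0 + 4 * 0"
          by (intro tendsto_intros)
        then show "(\<lambda>n. 4 * real n powr (- gap / 2)
          + 4 * ((3 / 4) powr ((ln (real n))\<^sup>2) * real n powr (real a * gap + gap / 2))) \<longlonglongrightarrow> 0"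
          unfolding u_def by simp
      qed simp
    qed
    then show "\<exists>T :: nat \<Rightarrow> nat. (\<forall>n. T0 < T n) \<and>
       (\<lambda>n. measure_pmf.prob (random_subset n (p n)) {S. unlikely S (T n)}) \<longlonglongrightarrow> 0"
      by (intro exI[of _ T]) (simp add: T_def)
  qed
qed

end

lemma distinct_solution_set:
  assumes "linear_equation A" "distinct_solution_in A S x"
  shows "($) x ` {..<dim_col A} \<in> solution_sets (dim_col A) (\<lambda>j. A $$ (0, j))"
    and "($) x ` {..<dim_col A} \<subseteq> S"
proof -
  have x: "x \<in> carrier_vec (dim_col A)" "A *\<^sub>v x = 0\<^sub>v (dim_row A)" "\<And>j. j < dim_col A \<Longrightarrow> x $ j \<in> S"
    and inj: "\<And>i j. i < dim_col A \<Longrightarrow> j < dim_col A \<Longrightarrow> i \<noteq> j \<Longrightarrow> x $ i \<noteq> x $ j"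
    using assms(2) unfolding distinct_solution_in_def solution_in_def by auto
  have r: "dim_row A = 1" using assms(1) by (simp add: linear_equation_def)
  have "(A *\<^sub>v x) $ 0 = (\<Sum>j<dim_col A. A $$ (0, j) * x $ j)"
    using x(1) r by (simp add: scalar_prod_def atLeast0LessThan)
  moreover have "(A *\<^sub>v x) $ 0 = 0" using x(2) r by simp
  ultimately have "(\<Sum>j<dim_col A. A $$ (0, j) * x $ j) = 0" by simp
  moreover have "inj_on (($) x) {..<dim_col A}" using inj by (auto simp: inj_on_def)
  ultimately show "($) x ` {..<dim_col A} \<in> solution_sets (dim_col A) (\<lambda>j. A $$ (0, j))"
    unfolding solution_sets_def by blast
  show "($) x ` {..<dim_col A} \<subseteq> S" using x(3) by auto
qed

text \<open>Colourings that use the first two colours only suffice.\<close>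

lemma rado_imp_uncolourable:
  assumes "2 \<le> r" and "\<And>i. i \<in> {1..r} \<Longrightarrow> linear_equation (A i)" and "\<And>i. i \<in> {1..r} \<Longrightarrow> 0 < dim_col (A i)"
    and "rado r A S"
  defines "edges_of i \<equiv> {g \<in> solution_sets (dim_col (A i)) (\<lambda>j. A i $$ (0, j)). g \<subseteq> S}"
  shows "uncolourable (edges_of 1) (edges_of 2)"
  unfolding uncolourable_def
proof
  fix D :: "int set"
  define colour :: "int \<Rightarrow> nat" where "colour s = (if s \<in> D then 1 else 2)" for s
  have "\<forall>s\<in>S. colour s \<in> {1..r}" using assms(1) by (auto simp: colour_def)
  then obtain i x where i: "i \<in> {1..r}" "distinct_solution_in (A i) S x" "\<forall>j<dim_col (A i). colour (x $ j) = i"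
    using assms(4) unfolding rado_def by blast
  define g where "g = ($) x ` {..<dim_col (A i)}"
  have g: "g \<in> edges_of i"
    using distinct_solution_set[OF assms(2)[OF i(1)] i(2)] by (simp add: edges_of_def g_def)
  have col: "colour s = i" if "s \<in> g" for s using that i(3) by (auto simp: g_def)
  have mem: "s \<in> D \<longleftrightarrow> i = 1" if "s \<in> g" for s
    using col[OF that] by (cases "s \<in> D") (auto simp: colour_def)
  have "colour (x $ 0) = i" using i(3) assms(3)[OF i(1)] by blast
  then have "i = 1 \<or> i = 2" by (auto simp: colour_def split: if_splits)
  then show "(\<exists>g\<in>edges_of 1. g \<subseteq> D) \<or> (\<exists>h\<in>edges_of 2. h \<inter> D = {})"
  proof
    assume "i = 1"
    then have "g \<subseteq> D" using mem by auto
    then show ?thesis using g \<open>i = 1\<close> by blast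
  next
    assume "i = 2"
    then have "g \<inter> D = {}" using mem by auto
    then show ?thesis using g \<open>i = 2\<close> by blast
  qed
qed

theorem corollary1p6:
  fixes r :: nat and A :: "nat \<Rightarrow> int mat"
  assumes "2 \<le> r"
    and "\<And>i. i \<in> {1..r} \<Longrightarrow> linear_equation (A i)"
    and "\<And>i. i \<in> {1..r} \<Longrightarrow> irredundant (A i)"
    and "\<And>i. i \<in> {1..r} \<Longrightarrow> partition_regular (A i)"
    and "\<And>i. i \<in> {1..r} \<Longrightarrow> 3 \<le> dim_col (A i)"
    and "\<And>i j. 1 \<le> i \<Longrightarrow> i \<le> j \<Longrightarrow> j \<le> r \<Longrightarrow> m_single (A j) \<le> m_single (A i)"
  shows "\<exists>c>0. \<forall>p :: nat \<Rightarrow> real.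
           (\<forall>n\<ge>1. 0 \<le> p n \<and> p n \<le> 1 \<and> p n < c * real n powr (- 1 / m_pair (A 1) (A 2))) \<longrightarrow>
           (\<lambda>n. measure_pmf.prob (random_subset n (p n)) {S. rado r A S}) \<longlonglongrightarrow> 0"
proof -
  have i12: "1 \<in> {1..r}" "2 \<in> {1..r}" using assms(1) by auto
  note eq = assms(2)[OF i12(1)] assms(2)[OF i12(2)]
  note dim3 = assms(5)[OF i12(1)] assms(5)[OF i12(2)]
  define a where "a = dim_col (A 1)"
  define b where "b = dim_col (A 2)"
  have ab: "3 \<le> a" "a \<le> b"
    using dim_col_le_if_m_single_ge[OF eq(1) dim3(1) eq(2) dim3(2)] assms(6)[of 1 2] assms(1) dim3
    by (simp_all add: a_def b_def)
  interpret two_equations a b "\<lambda>j. A 1 $$ (0, j)" "\<lambda>j. A 2 $$ (0, j)"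
    using ab eq by unfold_locales (auto simp: a_def b_def linear_equation_def)
  have "m_pair (A 1) (A 2) = real a * (real b - 1) / (real a * (real b - 1) - real b)"
    using m_pair_equations[OF eq(1) dim3(1) eq(2)] ab by (simp add: a_def b_def)
  then have "- 1 / m_pair (A 1) (A 2) = - (real a * (real b - 1) - real b) / (real a * (real b - 1))"
    by simp
  also have "\<dots> = size_exp - 1"
  proof -
    have "real a \<noteq> 0" "real b - 1 \<noteq> 0" using a3 ab by linarith+
    then have "real a * (real b - 1) \<noteq> 0" by simp
    then have "real a * (real b - 1) / (real a * (real b - 1)) = 1" by (rule divide_self)
    then show ?thesis unfolding size_exp_def minus_diff_eq diff_divide_distrib by simp
  qed
  finally have expo: "- 1 / m_pair (A 1) (A 2) = size_exp - 1" .
  have unlikely: "unlikely S T" if "rado r A S" "finite S" "b + 1 < T" for S T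
  proof (rule uncolourable_imp_unlikely[OF that(2,3)])
    have "\<And>i. i \<in> {1..r} \<Longrightarrow> 0 < dim_col (A i)" using assms(5) by fastforce
    from rado_imp_uncolourable[OF assms(1,2) this that(1)]
    show "uncolourable {g \<in> solution_sets a (\<lambda>j. A 1 $$ (0, j)). g \<subseteq> S} {g \<in> solution_sets b (\<lambda>j. A 2 $$ (0, j)). g \<subseteq> S}"
      by (simp add: a_def b_def)
  qed
  obtain c where c: "c > 0" and lim: "\<And>p :: nat \<Rightarrow> real. \<forall>n\<ge>1. 0 \<le> p n \<and> p n \<le> 1 \<and> p n < c * real n powr (size_exp - 1) \<Longrightarrow>
     \<forall>T0. \<exists>T :: nat \<Rightarrow> nat. (\<forall>n. T0 < T n) \<and>
       (\<lambda>n. measure_pmf.prob (random_subset n (p n)) {S. unlikely S (T n)}) \<longlonglongrightarrow> 0"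
    using prob_unlikely_tendsto_0 by blast
  show ?thesis
  proof (intro exI[of _ c] conjI allI impI c)
    fix p :: "nat \<Rightarrow> real"
    assume p: "\<forall>n\<ge>1. 0 \<le> p n \<and> p n \<le> 1 \<and> p n < c * real n powr (- 1 / m_pair (A 1) (A 2))"
    obtain T :: "nat \<Rightarrow> nat" where T: "\<And>n. b + 1 < T n"
      "(\<lambda>n. measure_pmf.prob (random_subset n (p n)) {S. unlikely S (T n)}) \<longlonglongrightarrow> 0"
      using lim[OF p[unfolded expo]] by blast
    have "measure_pmf.prob (random_subset n (p n)) {S. rado r A S}
        \<le> measure_pmf.prob (random_subset n (p n)) {S. unlikely S (T n)}" for n
    proof (rule measure_pmf.finite_measure_mono_AE)
      show "AE S in random_subset n (p n). S \<in> {S. rado r A S} \<longrightarrow> S \<in> {S. unlikely S (T n)}"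
        unfolding AE_measure_pmf_iff
        using unlikely[OF _ finite_subset[OF random_subset_subset] T(1)] by simp
    qed simp
    then show "(\<lambda>n. measure_pmf.prob (random_subset n (p n)) {S. rado r A S}) \<longlonglongrightarrow> 0"
      by (intro tendsto_sandwich[OF _ _ tendsto_const T(2)]) auto
  qed
qed

end
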